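(* Let $p \geq 1$ be a real number and let $E$ be a $\sigma$-Dedekind complete Banach lattice. (a) If $E$ has the $p$-weak $DP^\ast$ property, then $E$ has the disjoint Dunford-Pettis* property of order $p$ (disjoint $DP^\ast P_p$). (b) If $p \geq 2$, then $E$ has the $p$-weak $DP^\ast$ property if and only if $E$ has the disjoint $DP^\ast P_p$.
   Context: $E^\ast$ denotes the dual Banach lattice of $E$. A sequence $(x_n)_n$ in a Banach lattice is disjoint if $|x_n| \wedge |x_m| = 0$ whenever $n \neq m$. A sequence $(x_n)_n$ in a Banach space $X$ is weakly $p$-summable if $\sum_n |x^\ast(x_n)|^p < \infty$ for every $x^\ast \in X^\ast$. A subset $A$ of a Banach space $X$ is limited if every weak* null sequence in $X^\ast$ converges uniformly to zero on $A$. A bounded subset $A$ of a Banach lattice $E$ is almost limited if every disjoint weak* null sequence in $E^\ast$ converges uniformly to zero on $A$. A Banach lattice $E$ has the disjoint $DP^\ast P_p$ if, for every disjoint weakly $p$-summable sequence $(x_n)_n$ in $E$, the set $\{x_n : n \in \mathbb{N}\}$ is limited. A Banach lattice $E$ has the $p$-weak $DP^\ast$ property if every weakly $p$-compact subset of $E$ is almost limited (a set $A$ is weakly $p$-compact if every sequence in $A$ has a subsequence $(x_{n_j})_j$ such that $(x_{n_j}-x)_j$ is weakly $p$-summable for some $x \in A$); equivalently, if for every weakly $p$-summable sequence $(x_n)_n$ in $E$ and every disjoint weak* null sequence $(x_n^\ast)_n$ in $E^\ast$, it holds $x_n^\ast(x_n) \longrightarrow 0$. *)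

theory Defs
  imports "HOL-Analysis.Analysis" "HOL-Library.Lattice_Algebras"
begin

class banach_lattice = banach + ordered_real_vector + lattice_ab_group_add_abs +
  assumes abs_le_imp_norm_le: "\<bar>x\<bar> \<le> \<bar>y\<bar> \<Longrightarrow> norm x \<le> norm y"

instance real :: banach_lattice
  by standard simp

text \<open>Properties of the whole space are predicates on a type, passed as \<open>TYPE('a)\<close>.\<close>

definition sigma_dedekind_complete :: "'a::banach_lattice itself \<Rightarrow> bool" where
  "sigma_dedekind_complete _ \<longleftrightarrow>
     (\<forall>A::'a set. countable A \<and> A \<noteq> {} \<and> bdd_above A \<longrightarrow>
        (\<exists>s. (\<forall>a\<in>A. a \<le> s) \<and> (\<forall>u. (\<forall>a\<in>A. a \<le> u) \<longrightarrow> s \<le> u)))"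

definition disjoint_seq :: "(nat \<Rightarrow> 'a::banach_lattice) \<Rightarrow> bool" where
  "disjoint_seq x \<longleftrightarrow> (\<forall>m n. m \<noteq> n \<longrightarrow> inf \<bar>x m\<bar> \<bar>x n\<bar> = 0)"

text \<open>
  The dual of \<open>'a\<close> is the type \<open>'a \<Rightarrow>\<^sub>L real\<close> with the operator norm. It carries no
  order in the library; its Banach lattice order is the one given by the positive cone of \<open>'a\<close>,
  and the lattice operations are the suprema and infima for that order. They are written as
  relations because the order is not registered as a class instance.
\<close>

definition dual_le :: "('a::banach_lattice \<Rightarrow>\<^sub>L real) \<Rightarrow> ('a \<Rightarrow>\<^sub>L real) \<Rightarrow> bool" where
  "dual_le f g \<longleftrightarrow> (\<forall>x\<ge>0. blinfun_apply f x \<le> blinfun_apply g x)"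

definition is_dual_sup ::
  "('a::banach_lattice \<Rightarrow>\<^sub>L real) \<Rightarrow> ('a \<Rightarrow>\<^sub>L real) \<Rightarrow> ('a \<Rightarrow>\<^sub>L real) \<Rightarrow> bool" where
  "is_dual_sup f g h \<longleftrightarrow>
     dual_le f h \<and> dual_le g h \<and> (\<forall>k. dual_le f k \<and> dual_le g k \<longrightarrow> dual_le h k)"

definition is_dual_inf ::
  "('a::banach_lattice \<Rightarrow>\<^sub>L real) \<Rightarrow> ('a \<Rightarrow>\<^sub>L real) \<Rightarrow> ('a \<Rightarrow>\<^sub>L real) \<Rightarrow> bool" where
  "is_dual_inf f g h \<longleftrightarrow>
     dual_le h f \<and> dual_le h g \<and> (\<forall>k. dual_le k f \<and> dual_le k g \<longrightarrow> dual_le k h)"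

definition is_dual_abs :: "('a::banach_lattice \<Rightarrow>\<^sub>L real) \<Rightarrow> ('a \<Rightarrow>\<^sub>L real) \<Rightarrow> bool" where
  "is_dual_abs f h \<longleftrightarrow> is_dual_sup f (- f) h"

definition dual_disjoint_seq :: "(nat \<Rightarrow> ('a::banach_lattice \<Rightarrow>\<^sub>L real)) \<Rightarrow> bool" where
  "dual_disjoint_seq f \<longleftrightarrow>
     (\<forall>m n. m \<noteq> n \<longrightarrow>
        (\<exists>u v. is_dual_abs (f m) u \<and> is_dual_abs (f n) v \<and> is_dual_inf u v 0))"

definition weak_star_null :: "(nat \<Rightarrow> ('a::banach \<Rightarrow>\<^sub>L real)) \<Rightarrow> bool" where
  "weak_star_null f \<longleftrightarrow> (\<forall>x. (\<lambda>n. blinfun_apply (f n) x) \<longlonglongrightarrow> 0)"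

definition weakly_p_summable :: "real \<Rightarrow> (nat \<Rightarrow> 'a::banach) \<Rightarrow> bool" where
  "weakly_p_summable p x \<longleftrightarrow>
     (\<forall>f::'a \<Rightarrow>\<^sub>L real. summable (\<lambda>n. \<bar>blinfun_apply f (x n)\<bar> powr p))"

definition weakly_p_compact :: "real \<Rightarrow> 'a::banach set \<Rightarrow> bool" where
  "weakly_p_compact p A \<longleftrightarrow>
     (\<forall>x::nat \<Rightarrow> 'a. range x \<subseteq> A \<longrightarrow>
        (\<exists>r a. strict_mono r \<and> a \<in> A \<and> weakly_p_summable p (\<lambda>j. x (r j) - a)))"

definition limited :: "'a::banach set \<Rightarrow> bool" where
  "limited A \<longleftrightarrow>
     (\<forall>f. weak_star_null f \<longrightarrow>
        uniform_limit A (\<lambda>n. blinfun_apply (f n)) (\<lambda>_. 0) sequentially)"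

definition almost_limited :: "'a::banach_lattice set \<Rightarrow> bool" where
  "almost_limited A \<longleftrightarrow> bounded A \<and>
     (\<forall>f. dual_disjoint_seq f \<and> weak_star_null f \<longrightarrow>
        uniform_limit A (\<lambda>n. blinfun_apply (f n)) (\<lambda>_. 0) sequentially)"

definition disjoint_DP_star :: "real \<Rightarrow> 'a::banach_lattice itself \<Rightarrow> bool" where
  "disjoint_DP_star p _ \<longleftrightarrow>
     (\<forall>x::nat \<Rightarrow> 'a. disjoint_seq x \<and> weakly_p_summable p x \<longrightarrow> limited (range x))"

definition p_weak_DP_star :: "real \<Rightarrow> 'a::banach_lattice itself \<Rightarrow> bool" where
  "p_weak_DP_star p _ \<longleftrightarrow> (\<forall>A::'a set. weakly_p_compact p A \<longrightarrow> almost_limited A)"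

end

theory Submission
  imports Defs
begin

text \<open>
  Both implications compare two kinds of test: arbitrary weakly $p$-summable sequences against
  disjoint functionals, and disjoint weakly $p$-summable sequences against arbitrary functionals.
  By \<open>p_weak_DP_star_iff_sequential\<close> the $p$-weak $DP^*$ property says that $f_n(x_n) \to 0$ whenever
  $(x_n)$ is weakly $p$-summable and $(f_n)$ is disjoint and weak* null, so each implication amounts
  to transferring disjointness from one side of the pairing to the other.

  From vectors to functionals (\<open>disjoint_DP_star_if_sequential\<close>). If $(y_n)$ is disjoint and
  $(g_n)$ is weak* null, let $P_n$ be the projection onto the band generated by $y_n$, which exists
  because countable bounded suprema do. The functionals $g_n \circ P_n$ are disjoint and agree with
  $g_n$ at $y_n$. They are again weak* null: for $x \ge 0$ the vectors $P_n x$ are disjoint and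
  bounded by $x$, the suprema of subfamilies turn $g_n$ into a bounded finitely additive set function
  on the natural numbers, and Phillips' lemma (\<open>phillips_lemma\<close>), a gliding hump argument, gives
  $g_n(P_n x) \to 0$.

  From functionals to vectors (\<open>sequential_if_disjoint_DP_star\<close>). If $(f_n)$ is disjoint and weak*
  null then so is $(|f_n|)$ (\<open>weak_star_null_modulus\<close>): otherwise $|f_n|(x) \ge e$ for some $x \ge 0$
  along a subsequence, a pigeonhole argument produces disjoint $v_n$ in $[0, x]$ with
  $|f_n|(v_n) \ge e/2$, and this contradicts the result just quoted on disjoint sequences in order
  intervals. Now suppose $|f_n(x_n)| \ge e$, so that $|f_n|(|x_n|) \ge e$. Since $(|f_n|)$ is weak* null,
  a subsequence of $(|x_n|)$ can be cut down to disjoint vectors $0 \le z_n \le |x_n|$ with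
  $|f_n|(z_n) \ge e/2$ (\<open>disjoint_minorants_of_bounded_seq\<close>). Weak $p$-summability passes from
  $(x_n)$ to the disjoint minorants $(z_n)$ (\<open>weakly_p_summable_disjoint_minorant\<close>), because a sum of
  disjoint vectors is their supremum, and $\sup_n |y_n|$ is dominated by the average of
  $|\sum_n \pm y_n|$ over all signs. So $\{z_n\}$ would be limited, although $|f_n|(z_n) \ge e/2$.
\<close>

section \<open>Vector lattices\<close>

lemma abs_eq_sup: "\<bar>x::'a::banach_lattice\<bar> = sup x (- x)"
  by (rule abs_lattice)

lemma diff_pprt: "pprt x - pprt (- x) = (x::'a::banach_lattice)"
  using prts[of x] by (simp add: pprt_neg)

lemma add_pprt: "pprt x + pprt (- x) = \<bar>x::'a::banach_lattice\<bar>"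
  by (simp add: abs_prts pprt_neg)

lemma pprt_le_abs: "pprt x \<le> \<bar>x::'a::banach_lattice\<bar>" "pprt (- x) \<le> \<bar>x\<bar>"
  using add_pprt[of x] zero_le_pprt[of x] zero_le_pprt[of "- x"]
  by (metis add.commute le_add_same_cancel1)+

lemma norm_abs_lattice [simp]: "norm \<bar>x::'a::banach_lattice\<bar> = norm x"
  by (intro antisym abs_le_imp_norm_le) simp_all

lemma norm_mono_pos: "0 \<le> x \<Longrightarrow> x \<le> y \<Longrightarrow> norm x \<le> norm (y::'a::banach_lattice)"
  by (rule abs_le_imp_norm_le) (metis abs_of_nonneg order_trans)

lemma norm_pprt_le: "norm (pprt x) \<le> norm (x::'a::banach_lattice)"
  "norm (pprt (- x)) \<le> norm x"
  using norm_mono_pos[OF zero_le_pprt pprt_le_abs(1)] norm_mono_pos[OF zero_le_pprt pprt_le_abs(2)]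
  by simp_all

lemma abs_le_lattice_iff: "\<bar>x::'a::banach_lattice\<bar> \<le> y \<longleftrightarrow> - y \<le> x \<and> x \<le> y"
  by (metis abs_eq_sup le_sup_iff minus_le_iff)

lemma scaleR_inf_lattice:
  fixes a b :: "'a::banach_lattice"
  assumes "0 \<le> c"
  shows "c *\<^sub>R inf a b = inf (c *\<^sub>R a) (c *\<^sub>R b)"
proof (cases "c = 0")
  case False
  with assms have c: "0 < c" by simp
  show ?thesis
  proof (intro antisym le_infI)
    have "inverse c *\<^sub>R inf (c *\<^sub>R a) (c *\<^sub>R b) \<le> inf a b"
      using c scaleR_left_mono[OF inf_le1, of "inverse c" "c *\<^sub>R a" "c *\<^sub>R b"]
        scaleR_left_mono[OF inf_le2, of "inverse c" "c *\<^sub>R a" "c *\<^sub>R b"]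
      by (intro le_infI) simp_all
    from scaleR_left_mono[OF this, of c] c
    show "inf (c *\<^sub>R a) (c *\<^sub>R b) \<le> c *\<^sub>R inf a b" by simp
  qed (use c in \<open>auto intro!: scaleR_left_mono\<close>)
qed simp

lemma inf_add_le:
  fixes a b c :: "'a::banach_lattice"
  assumes "0 \<le> a" "0 \<le> b" "0 \<le> c"
  shows "inf (a + b) c \<le> inf a c + inf b c"
proof -
  have "inf a c + inf b c = inf (inf (a + b) (a + c)) (inf (c + b) (c + c))"
    by (simp add: add_inf_distrib_left add_inf_distrib_right inf_assoc inf_commute inf_left_commute)
  moreover have "inf (a + b) c \<le> a + c" "inf (a + b) c \<le> c + b" "inf (a + b) c \<le> c + c"
    using assms by (auto intro: le_infI2)
  ultimately show ?thesis by simp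
qed

lemma disjoint_antimono:
  fixes a b :: "'a::banach_lattice"
  assumes "inf a b = 0" "0 \<le> a'" "a' \<le> a" "0 \<le> b'" "b' \<le> b"
  shows "inf a' b' = 0"
  using inf_mono[OF assms(3,5)] assms by (intro antisym) auto

text \<open>Both arguments are enlarged to the common multiple by \<open>max 1 c\<close>, which preserves disjointness.\<close>
lemma disjoint_scaleR:
  fixes a b :: "'a::banach_lattice"
  assumes "inf a b = 0" "0 \<le> c"
  shows "inf a (c *\<^sub>R b) = 0"
proof -
  have ab: "0 \<le> a" "0 \<le> b" using assms(1) by (metis inf_le1 inf_le2)+
  define m where "m = max 1 c"
  have "a \<le> m *\<^sub>R a" using ab scaleR_right_mono[of 1 m a] by (simp add: m_def)
  moreover have "c *\<^sub>R b \<le> m *\<^sub>R b" using ab by (intro scaleR_right_mono) (auto simp: m_def)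
  moreover have "inf (m *\<^sub>R a) (m *\<^sub>R b) = 0"
    using scaleR_inf_lattice[of m a b] assms by (simp add: m_def)
  ultimately show ?thesis
    using disjoint_antimono[of "m *\<^sub>R a" "m *\<^sub>R b" a "c *\<^sub>R b"] ab
      scaleR_nonneg_nonneg[OF assms(2) ab(2)] by blast
qed

lemma disjoint_pprt: "inf (pprt a) (pprt (- a)) = (0::'a::banach_lattice)"
proof -
  have "inf (pprt a) (pprt (- a)) = pprt (- a) + inf a 0"
    using diff_pprt[of a] by (simp add: add_inf_distrib_left)
       (metis add.commute diff_add_cancel)
  also have "\<dots> = 0" by (simp only: pprt_neg nprt_def left_minus)
  finally show ?thesis .
qed

text \<open>For disjoint vectors the sum is the supremum.\<close>
lemma disjoint_add_le:
  fixes a b :: "'a::banach_lattice"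
  assumes "inf a b = 0" "a \<le> s" "b \<le> s"
  shows "a + b \<le> s"
  using add_eq_inf_sup[of a b] assms by simp

text \<open>The band orthogonal to a given element is closed under suprema: if \<open>s\<close> is the supremum of
  elements disjoint from \<open>a\<close>, then \<open>s - inf a s\<close> is still an upper bound for them.\<close>
lemma disjoint_Sup:
  fixes a s :: "'a::banach_lattice"
  assumes ne: "A \<noteq> {}" and pos: "0 \<le> a" "0 \<le> s" and dis: "\<And>z. z \<in> A \<Longrightarrow> inf a z = 0"
    and ub: "\<And>z. z \<in> A \<Longrightarrow> z \<le> s" and lub: "\<And>u. (\<And>z. z \<in> A \<Longrightarrow> z \<le> u) \<Longrightarrow> s \<le> u"
  shows "inf a s = 0"
proof -
  have "z \<le> s - inf a s" if z: "z \<in> A" for z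
  proof -
    have "inf (inf a s) z = 0"
      using disjoint_antimono[OF dis[OF z], of "inf a s" z] pos dis[OF z] inf_le2[of a z] by simp
    then have "inf a s + z \<le> s" using ub[OF z] by (intro disjoint_add_le) auto
    then show ?thesis by (simp only: le_diff_eq add.commute)
  qed
  then have "s \<le> s - inf a s" by (rule lub)
  then have "inf a s \<le> 0" by (simp only: le_diff_eq add_le_same_cancel1)
  with pos show ?thesis by (intro antisym) auto
qed

lemma abs_scaleR_lattice:
  fixes x :: "'a::banach_lattice"
  assumes "0 \<le> c"
  shows "\<bar>c *\<^sub>R x\<bar> = c *\<^sub>R \<bar>x\<bar>"
proof -
  have abs: "\<bar>z\<bar> = - inf (- z) z" for z :: 'a by (simp add: abs_eq_sup neg_inf_eq_sup)
  show ?thesis unfolding abs using assms by (simp only: scaleR_minus_right scaleR_inf_lattice)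
qed

text \<open>Disjointness from a fixed vector survives finite sums, by subadditivity of \<open>inf\<close> on the cone.\<close>
lemma disjoint_sum:
  fixes v :: "nat \<Rightarrow> 'a::banach_lattice"
  assumes "0 \<le> b" "\<And>i. i < n \<Longrightarrow> 0 \<le> v i" "\<And>i. i < n \<Longrightarrow> inf (v i) b = 0"
  shows "inf (\<Sum>i<n. v i) b = 0"
  using assms(2,3)
proof (induction n)
  case (Suc n)
  have s: "0 \<le> (\<Sum>i<n. v i)" using Suc.prems(1) by (intro sum_nonneg) simp
  have "inf ((\<Sum>i<n. v i) + v n) b \<le> inf (\<Sum>i<n. v i) b + inf (v n) b"
    by (rule inf_add_le) (use s assms(1) Suc.prems(1) in auto)
  also have "\<dots> = 0" using Suc.IH Suc.prems by simp
  finally show ?case using s assms(1) Suc.prems(1)[of n] by (intro antisym) auto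
qed (use assms(1) in \<open>simp add: inf_absorb1\<close>)

lemma disjoint_sum_le:
  fixes v :: "nat \<Rightarrow> 'a::banach_lattice"
  assumes "0 \<le> u" "\<And>i. i < n \<Longrightarrow> 0 \<le> v i" "\<And>i. i < n \<Longrightarrow> v i \<le> u"
    "\<And>i j. i < n \<Longrightarrow> j < n \<Longrightarrow> i \<noteq> j \<Longrightarrow> inf (v i) (v j) = 0"
  shows "(\<Sum>i<n. v i) \<le> u"
  using assms(2-)
proof (induction n)
  case (Suc n)
  have "inf (\<Sum>i<n. v i) (v n) = 0"
    by (rule disjoint_sum) (use Suc.prems in auto)
  then have "(\<Sum>i<n. v i) + v n \<le> u"
    by (rule disjoint_add_le) (use Suc in auto)
  then show ?case by simp
qed (use assms(1) in simp)

lemma le_sum_member: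
  fixes f :: "'i \<Rightarrow> 'a::ordered_comm_monoid_add"
  assumes "finite A" "i \<in> A" "\<And>j. j \<in> A \<Longrightarrow> 0 \<le> f j"
  shows "f i \<le> sum f A"
  using sum_mono2[of A "{i}" f] assms by simp

text \<open>The positive cone is norm closed: \<open>pprt (c - x)\<close> is dominated by \<open>\<bar>a n - x\<bar>\<close> and hence has norm 0.\<close>
lemma lattice_le_limit:
  fixes c :: "'a::banach_lattice"
  assumes a: "a \<longlonglongrightarrow> x" and le: "eventually (\<lambda>n. c \<le> a n) sequentially"
  shows "c \<le> x"
proof -
  have "(\<lambda>n. norm (a n - x)) \<longlonglongrightarrow> 0" using a by (simp add: tendsto_norm_zero LIM_zero)
  moreover have "eventually (\<lambda>n. norm (pprt (c - x)) \<le> norm (a n - x)) sequentially"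
    using le
  proof eventually_elim
    case (elim n)
    then have "pprt (c - x) \<le> pprt (a n - x)" by (intro pprt_mono) simp
    also have "\<dots> \<le> \<bar>a n - x\<bar>" by (rule pprt_le_abs)
    finally show ?case using norm_mono_pos[OF zero_le_pprt] by fastforce
  qed
  ultimately have "norm (pprt (c - x)) \<le> 0" by (rule tendsto_lowerbound) simp
  then have "pprt (c - x) = 0" by simp
  then show ?thesis using le_zero_iff_zero_pprt[of "c - x"] by simp
qed

text \<open>The first summand is \<open>y\<close> truncated to the order interval \<open>[-a, a]\<close>.\<close>
lemma riesz_decomposition:
  fixes a b y :: "'a::banach_lattice"
  assumes "0 \<le> a" "0 \<le> b" "\<bar>y\<bar> \<le> a + b"
  obtains y1 y2 where "y = y1 + y2" "\<bar>y1\<bar> \<le> a" "\<bar>y2\<bar> \<le> b"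
proof
  define y1 where "y1 = sup (inf y a) (- a)"
  have y: "- (a + b) \<le> y" "y \<le> a + b" using assms(3) by (simp_all only: abs_le_lattice_iff)
  show "y = y1 + (y - y1)" by simp
  have "inf y a \<le> a" "- a \<le> a" using assms(1) by (auto simp: minus_le_self_iff)
  then show "\<bar>y1\<bar> \<le> a" by (simp add: abs_le_lattice_iff y1_def)
  have "y \<le> b + inf y a" using assms y by (simp add: add_inf_distrib_left add.commute)
  also have "\<dots> \<le> b + y1" by (simp add: y1_def)
  finally have 1: "y - y1 \<le> b" by (simp add: algebra_simps)
  have "inf y a \<le> y + b" using assms by (simp add: le_infI1)
  moreover have "- a \<le> y + b" using y by (simp add: algebra_simps)
  ultimately have "y1 \<le> y + b" by (simp add: y1_def)
  then have "- b \<le> y - y1" by (simp add: algebra_simps)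
  with 1 show "\<bar>y - y1\<bar> \<le> b" by (simp add: abs_le_lattice_iff)
qed

section \<open>Functionals on a Banach lattice\<close>

abbreviation positive_functional :: "('a::banach_lattice \<Rightarrow>\<^sub>L real) \<Rightarrow> bool" where
  "positive_functional u \<equiv> dual_le 0 u"

lemma positive_functional_nonneg: "positive_functional u \<Longrightarrow> 0 \<le> x \<Longrightarrow> 0 \<le> blinfun_apply u x"
  by (simp add: dual_le_def)

lemma positive_functional_mono:
  "positive_functional u \<Longrightarrow> x \<le> y \<Longrightarrow> blinfun_apply u x \<le> blinfun_apply u y"
  using positive_functional_nonneg[of u "y - x"] by (simp add: blinfun.diff_right)

lemma functional_eqI:
  fixes f g :: "'a::banach_lattice \<Rightarrow>\<^sub>L real"
  assumes "\<And>x. 0 \<le> x \<Longrightarrow> blinfun_apply f x = blinfun_apply g x"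
  shows "f = g"
proof (rule blinfun_eqI)
  fix x
  show "blinfun_apply f x = blinfun_apply g x"
    using assms[of "pprt x"] assms[of "pprt (- x)"]
    by (metis blinfun.diff_right diff_pprt zero_le_pprt)
qed

text \<open>Every vector is a difference of positive ones, and additivity makes \<open>q a - q b\<close> depend only on
  \<open>a - b\<close>. Moduli and compositions with band projections are obtained as linear
  functionals in this way.\<close>
lemma cone_additive_extension:
  fixes q :: "'a::banach_lattice \<Rightarrow> real"
  assumes add: "\<And>x y. 0 \<le> x \<Longrightarrow> 0 \<le> y \<Longrightarrow> q (x + y) = q x + q y"
    and scale: "\<And>c x. 0 \<le> c \<Longrightarrow> 0 \<le> x \<Longrightarrow> q (c *\<^sub>R x) = c * q x"
    and bound: "\<And>x. 0 \<le> x \<Longrightarrow> \<bar>q x\<bar> \<le> C * norm x"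
  obtains F where "\<And>x. 0 \<le> x \<Longrightarrow> blinfun_apply F x = q x"
proof
  define G where "G x = q (pprt x) - q (pprt (- x))" for x :: 'a
  have G: "G (a - b) = q a - q b" if "0 \<le> a" "0 \<le> b" for a b
  proof -
    have "a + pprt (- (a - b)) = pprt (a - b) + b"
      using diff_pprt[of "a - b"] by (simp add: algebra_simps)
    then have "q a + q (pprt (- (a - b))) = q (pprt (a - b)) + q b"
      using add that by (metis zero_le_pprt)
    then show ?thesis by (simp add: G_def)
  qed
  have "bounded_linear G"
  proof (rule bounded_linear_intro)
    fix x y :: 'a
    have "x + y = (pprt x + pprt y) - (pprt (- x) + pprt (- y))"
      using diff_pprt[of x] diff_pprt[of y] by (simp add: algebra_simps)
    then have "G (x + y) = q (pprt x + pprt y) - q (pprt (- x) + pprt (- y))"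
      using G by (metis add_nonneg_nonneg zero_le_pprt)
    then show "G (x + y) = G x + G y" by (simp add: add G_def)
  next
    fix c and x :: 'a
    show "G (c *\<^sub>R x) = c *\<^sub>R G x"
    proof (cases "0 \<le> c")
      case True
      have "c *\<^sub>R x = c *\<^sub>R pprt x - c *\<^sub>R pprt (- x)"
        by (simp add: scaleR_diff_right[symmetric] diff_pprt)
      then have "G (c *\<^sub>R x) = q (c *\<^sub>R pprt x) - q (c *\<^sub>R pprt (- x))"
        using G True by (metis scaleR_nonneg_nonneg zero_le_pprt)
      then show ?thesis using True by (simp add: scale G_def algebra_simps)
    next
      case False
      have "c *\<^sub>R x = (- c) *\<^sub>R pprt (- x) - (- c) *\<^sub>R pprt x"
        by (metis diff_pprt minus_diff_eq scaleR_minus_left scaleR_minus_right scaleR_diff_right)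
      then have "G (c *\<^sub>R x) = q ((- c) *\<^sub>R pprt (- x)) - q ((- c) *\<^sub>R pprt x)"
        using G False by (metis le_minus_iff linorder_not_le minus_zero order_less_imp_le scaleR_nonneg_nonneg zero_le_pprt)
      then show ?thesis using False scale[of "- c"] by (simp add: G_def algebra_simps)
    qed
  next
    fix x :: 'a
    have C: "C * norm y \<le> \<bar>C\<bar> * norm x" if "norm y \<le> norm x" for y
      using that by (intro mult_mono) auto
    have "\<bar>q (pprt x)\<bar> \<le> \<bar>C\<bar> * norm x" "\<bar>q (pprt (- x))\<bar> \<le> \<bar>C\<bar> * norm x"
      using bound[OF zero_le_pprt, of x] bound[OF zero_le_pprt, of "- x"]
        C[OF norm_pprt_le(1)] C[OF norm_pprt_le(2)] by linarith+
    then have "\<bar>G x\<bar> \<le> 2 * (\<bar>C\<bar> * norm x)" unfolding G_def by linarith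
    then show "norm (G x) \<le> norm x * (2 * \<bar>C\<bar>)" by (simp add: algebra_simps)
  qed
  then show "blinfun_apply (Blinfun G) x = q x" if "0 \<le> x" for x
    using G[of x 0] that scale[of 0 0] by (simp add: bounded_linear_Blinfun_apply)
qed

text \<open>The Riesz-Kantorovich theorem: \<open>q x = Sup {f y | \<bar>y\<bar> \<le> x}\<close> is additive on the cone by the Riesz
  decomposition, and its linear extension is the modulus. The last two conclusions together say that
  the modulus is given by this supremum.\<close>
lemma dual_modulus_exists:
  fixes f :: "'a::banach_lattice \<Rightarrow>\<^sub>L real"
  obtains u where "is_dual_abs f u"
    and "\<And>x e. 0 \<le> x \<Longrightarrow> 0 < e \<Longrightarrow> \<exists>y. \<bar>y\<bar> \<le> x \<and> blinfun_apply u x - e < blinfun_apply f y"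
    and "\<And>x y. \<bar>y\<bar> \<le> x \<Longrightarrow> blinfun_apply f y \<le> blinfun_apply u x"
proof -
  define S where "S x = {blinfun_apply f y | y. \<bar>y\<bar> \<le> x}" for x
  define q where "q x = Sup (S x)" for x
  have ub: "s \<le> norm f * norm x" if "s \<in> S x" for s x
  proof -
    from that obtain y where y: "s = blinfun_apply f y" "\<bar>y\<bar> \<le> x" by (auto simp: S_def)
    then have "norm y \<le> norm x" by (intro abs_le_imp_norm_le) (metis abs_ge_self order_trans)
    then show ?thesis using y norm_blinfun[of f y] mult_left_mono[of "norm y" "norm x" "norm f"]
      by (simp add: abs_le_iff)
  qed
  have bdd: "bdd_above (S x)" for x using ub by (meson bdd_aboveI)
  have q_ub: "blinfun_apply f y \<le> q x" if "\<bar>y\<bar> \<le> x" for x y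
    unfolding q_def using that by (intro cSup_upper bdd) (auto simp: S_def)
  have ne: "0 \<in> S x" if "0 \<le> x" for x using that by (auto simp: S_def intro!: exI[of _ 0])
  have q_lub: "q x \<le> c" if "0 \<le> x" "\<And>y. \<bar>y\<bar> \<le> x \<Longrightarrow> blinfun_apply f y \<le> c" for x c
    unfolding q_def using that(2) ne[OF that(1)] by (intro cSup_least) (auto simp: S_def)
  have q_approx: "\<exists>y. \<bar>y\<bar> \<le> x \<and> q x - e < blinfun_apply f y" if "0 \<le> x" "0 < e" for x e
    using q_lub[OF that(1), of "q x - e"] that(2) by force
  have add: "q (x + y) = q x + q y" if pos: "0 \<le> x" "0 \<le> y" for x y
  proof (rule antisym)
    show "q (x + y) \<le> q x + q y"
    proof (rule q_lub)
      fix z assume "\<bar>z\<bar> \<le> x + y"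
      then obtain z1 z2 where "z = z1 + z2" "\<bar>z1\<bar> \<le> x" "\<bar>z2\<bar> \<le> y"
        using riesz_decomposition pos by metis
      then show "blinfun_apply f z \<le> q x + q y"
        using q_ub by (metis add_mono blinfun.add_right)
    qed (use pos in simp)
    \<comment> \<open>superadditivity: the two suprema are taken one after the other\<close>
    have "q x \<le> q (x + y) - q y"
    proof (rule q_lub[OF pos(1)])
      fix a assume a: "\<bar>a\<bar> \<le> x"
      have "q y \<le> q (x + y) - blinfun_apply f a"
      proof (rule q_lub[OF pos(2)])
        fix b assume b: "\<bar>b\<bar> \<le> y"
        have "\<bar>a + b\<bar> \<le> x + y" using a b abs_triangle_ineq[of a b] by (meson add_mono order_trans)
        from q_ub[OF this] show "blinfun_apply f b \<le> q (x + y) - blinfun_apply f a"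
          by (simp add: blinfun.add_right)
      qed
      then show "blinfun_apply f a \<le> q (x + y) - q y" by simp
    qed
    then show "q x + q y \<le> q (x + y)" by simp
  qed
  have abs_scale: "\<bar>c *\<^sub>R y\<bar> \<le> c *\<^sub>R x" if "0 \<le> c" "\<bar>y\<bar> \<le> x" for c x and y :: 'a
    using that scaleR_left_mono[of y x c] scaleR_left_mono[of "- x" y c]
    by (simp add: abs_le_lattice_iff)
  have scale_le: "c * q x \<le> q (c *\<^sub>R x)" if c: "0 \<le> c" "0 \<le> x" for c x
  proof (cases "c = 0")
    case False
    have "q x \<le> q (c *\<^sub>R x) / c"
    proof (rule q_lub[OF c(2)])
      fix y assume "\<bar>y\<bar> \<le> x"
      from q_ub[OF abs_scale[OF c(1) this]] False c(1)
      show "blinfun_apply f y \<le> q (c *\<^sub>R x) / c"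
        by (simp add: blinfun.scaleR_right field_simps)
    qed
    then show ?thesis using False c(1) by (simp add: field_simps)
  next
    case True
    then show ?thesis using q_ub[of 0 0] by simp
  qed
  have q0: "q 0 = 0" using add[of 0 0] by simp
  have scale: "q (c *\<^sub>R x) = c * q x" if c: "0 \<le> c" "0 \<le> x" for c x
  proof (cases "c = 0")
    case False
    have "inverse c * q (c *\<^sub>R x) \<le> q (inverse c *\<^sub>R c *\<^sub>R x)"
      using c by (intro scale_le) (auto intro: scaleR_nonneg_nonneg)
    then have "q (c *\<^sub>R x) \<le> c * q x" using False c(1) by (simp add: field_simps)
    then show ?thesis using scale_le[OF c] by simp
  qed (simp add: q0)
  have bound: "\<bar>q x\<bar> \<le> norm f * norm x" if "0 \<le> x" for x
  proof -
    have "q x \<le> norm f * norm x" using q_lub[OF that] ub by (auto simp: S_def)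
    moreover have "0 \<le> q x" using q_ub[of 0 x] that by simp
    ultimately show ?thesis by simp
  qed
  from cone_additive_extension[of q, OF add scale bound]
  obtain u where u: "\<And>x. 0 \<le> x \<Longrightarrow> blinfun_apply u x = q x" by blast
  have "is_dual_abs f u"
    unfolding is_dual_abs_def is_dual_sup_def dual_le_def
  proof (intro conjI allI impI)
    fix x :: 'a assume x: "0 \<le> x"
    show "blinfun_apply f x \<le> blinfun_apply u x" using q_ub[of x x] x u by simp
    show "blinfun_apply (- f) x \<le> blinfun_apply u x"
      using q_ub[of "- x" x] x u by (simp add: blinfun.minus_right blinfun.minus_left)
  next
    fix k :: "'a \<Rightarrow>\<^sub>L real" and x :: 'a
    assume k: "(\<forall>x\<ge>0. blinfun_apply f x \<le> blinfun_apply k x) \<and>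
      (\<forall>x\<ge>0. blinfun_apply (- f) x \<le> blinfun_apply k x)" and x: "0 \<le> x"
    have kpos: "0 \<le> blinfun_apply k x" if "0 \<le> x" for x
    proof -
      have "blinfun_apply f x \<le> blinfun_apply k x" "- blinfun_apply f x \<le> blinfun_apply k x"
        using k that by (auto simp: blinfun.minus_left)
      then show ?thesis by linarith
    qed
    have "q x \<le> blinfun_apply k x"
    proof (rule q_lub[OF x])
      fix y assume y: "\<bar>y\<bar> \<le> x"
      have "blinfun_apply f y = blinfun_apply f (pprt y) - blinfun_apply f (pprt (- y))"
        by (simp add: diff_pprt flip: blinfun.diff_right)
      also have "\<dots> \<le> blinfun_apply k (pprt y) + blinfun_apply k (pprt (- y))"
        using k zero_le_pprt[of y] zero_le_pprt[of "- y"]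
        by (smt (verit) blinfun.minus_left)
      also have "\<dots> = blinfun_apply k x - blinfun_apply k (x - \<bar>y\<bar>)"
        by (simp add: blinfun.diff_right add_pprt flip: blinfun.add_right)
      also have "\<dots> \<le> blinfun_apply k x" using kpos[of "x - \<bar>y\<bar>"] y by simp
      finally show "blinfun_apply f y \<le> blinfun_apply k x" .
    qed
    then show "blinfun_apply u x \<le> blinfun_apply k x" using u x by simp
  qed
  moreover have "0 \<le> x" if "\<bar>y\<bar> \<le> x" for x y :: 'a using that abs_ge_zero order_trans by blast
  ultimately show thesis using that[of u] u q_approx q_ub by metis
qed

lemma is_dual_abs_unique: "is_dual_abs f u \<Longrightarrow> is_dual_abs f v \<Longrightarrow> u = v"
  unfolding is_dual_abs_def is_dual_sup_def
  by (intro functional_eqI) (meson antisym dual_le_def)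

text \<open>Transfers the supremum formula from the modulus constructed above to any modulus.\<close>
lemma dual_modulus_formula:
  assumes "is_dual_abs f u"
  shows "0 \<le> x \<Longrightarrow> 0 < e \<Longrightarrow> \<exists>y. \<bar>y\<bar> \<le> x \<and> blinfun_apply u x - e < blinfun_apply f y"
    and "\<bar>y\<bar> \<le> x \<Longrightarrow> blinfun_apply f y \<le> blinfun_apply u x"
proof -
  obtain v where v: "is_dual_abs f v"
    "\<And>x e. 0 \<le> x \<Longrightarrow> 0 < e \<Longrightarrow> \<exists>y. \<bar>y\<bar> \<le> x \<and> blinfun_apply v x - e < blinfun_apply f y"
    "\<And>x y. \<bar>y\<bar> \<le> x \<Longrightarrow> blinfun_apply f y \<le> blinfun_apply v x"
    by (rule dual_modulus_exists[of f]) blast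
  have "u = v" using assms v(1) by (rule is_dual_abs_unique)
  with v(2,3) show "0 \<le> x \<Longrightarrow> 0 < e \<Longrightarrow> \<exists>y. \<bar>y\<bar> \<le> x \<and> blinfun_apply u x - e < blinfun_apply f y"
    "\<bar>y\<bar> \<le> x \<Longrightarrow> blinfun_apply f y \<le> blinfun_apply u x" by simp_all
qed

lemma dual_modulus_ge:
  assumes "is_dual_abs f u" "\<bar>y\<bar> \<le> x"
  shows "\<bar>blinfun_apply f y\<bar> \<le> blinfun_apply u x"
proof -
  from dual_modulus_formula(2)[OF assms(1), of y x] dual_modulus_formula(2)[OF assms(1), of "- y" x]
    assms(2) show ?thesis by (simp add: blinfun.minus_right)
qed

lemma dual_modulus_pos: "is_dual_abs f u \<Longrightarrow> positive_functional u"
  using dual_modulus_ge[of f u 0] by (auto simp: dual_le_def)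

lemma dual_modulus_le_norm:
  assumes "is_dual_abs f u" "0 \<le> x"
  shows "blinfun_apply u x \<le> norm f * norm x"
proof (rule field_le_epsilon)
  fix e :: real assume "0 < e"
  from dual_modulus_formula(1)[OF assms this] obtain y
    where y: "\<bar>y\<bar> \<le> x" "blinfun_apply u x - e < blinfun_apply f y" by blast
  from y(1) assms(2) have "norm y \<le> norm x" by (intro abs_le_imp_norm_le) simp
  then show "blinfun_apply u x \<le> norm f * norm x + e"
    using y(2) norm_blinfun[of f y] mult_left_mono[of "norm y" "norm x" "norm f"]
    by (simp add: abs_le_iff)
qed

text \<open>Disjointness in the dual, read off from \<open>inf u v = (u + v - \<bar>u - v\<bar>) / 2\<close> and the formula
  for the modulus: every positive \<open>x\<close> splits into a part where \<open>u\<close> is small and one where \<open>v\<close>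
  is small.\<close>
lemma disjoint_functionals_split:
  fixes u v :: "'a::banach_lattice \<Rightarrow>\<^sub>L real"
  assumes pos: "positive_functional u" "positive_functional v" and dis: "is_dual_inf u v 0"
    and x: "0 \<le> x" and e: "0 < e"
  shows "\<exists>w. 0 \<le> w \<and> w \<le> x \<and> blinfun_apply u (x - w) < e \<and> blinfun_apply v w < e"
proof -
  obtain m where m: "is_dual_abs (u - v) m" by (rule dual_modulus_exists)
  define k where "k = (1/2) *\<^sub>R (u + v - m)"
  have "dual_le (u - v) m" "dual_le (v - u) m"
    using m by (simp_all add: is_dual_abs_def is_dual_sup_def)
  then have "dual_le k u" "dual_le k v"
    by (auto simp: dual_le_def k_def blinfun.scaleR_left blinfun.diff_left blinfun.add_left
        algebra_simps)
  then have "dual_le k 0" using dis by (auto simp: is_dual_inf_def)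
  then have le: "blinfun_apply u x + blinfun_apply v x \<le> blinfun_apply m x"
    using x by (auto simp: dual_le_def k_def blinfun.scaleR_left blinfun.diff_left blinfun.add_left)
  from dual_modulus_formula(1)[OF m x e] obtain y
    where y: "\<bar>y\<bar> \<le> x" "blinfun_apply m x - e < blinfun_apply (u - v) y" by blast
  define w where "w = pprt y"
  define t where "t = pprt (- y)"
  have wt: "0 \<le> w" "0 \<le> t" "w \<le> x" "y = w - t"
    using y(1) pprt_le_abs[of y] diff_pprt[of y] by (auto simp: w_def t_def)
  have "blinfun_apply u (x - w) + blinfun_apply u t + blinfun_apply v w + blinfun_apply v (x - t) < e"
    using y(2) le by (simp add: wt(4) blinfun.diff_right blinfun.diff_left)
  moreover have "t \<le> x" using y(1) pprt_le_abs[of y] by (auto simp: t_def)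
  ultimately show ?thesis
    using wt positive_functional_nonneg[OF pos(1)] positive_functional_nonneg[OF pos(2)]
    by (smt (verit) diff_ge_0_iff_ge)
qed

section \<open>The Hahn-Banach theorem and uniform boundedness\<close>

definition sublinear :: "('a::real_vector \<Rightarrow> real) \<Rightarrow> bool" where
  "sublinear q \<longleftrightarrow> (\<forall>x y. q (x + y) \<le> q x + q y) \<and> (\<forall>c\<ge>0. \<forall>x. q (c *\<^sub>R x) = c * q x)"

lemma sublinearI:
  fixes q :: "'a::real_vector \<Rightarrow> real"
  assumes add: "\<And>x y. q (x + y) \<le> q x + q y" and zero: "q 0 \<le> 0"
    and scale: "\<And>c x. 0 < c \<Longrightarrow> q (c *\<^sub>R x) \<le> c * q x"
  shows "sublinear q"
proof -
  have q0: "q 0 = 0" using add[of 0 0] zero by simp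
  have "q (c *\<^sub>R x) = c * q x" if "0 \<le> c" for c x
  proof (cases "c = 0")
    case False
    with that have c: "0 < c" by simp
    have "q (inverse c *\<^sub>R c *\<^sub>R x) \<le> inverse c * q (c *\<^sub>R x)" using c by (intro scale) simp
    then have "c * q x \<le> q (c *\<^sub>R x)" using c by (simp add: field_simps)
    with scale[OF c] show ?thesis by (meson antisym)
  qed (simp add: q0)
  with add show ?thesis by (simp add: sublinear_def)
qed

lemma
  assumes "sublinear q"
  shows sublinear_add: "q (x + y) \<le> q x + q y"
    and sublinear_scale: "0 \<le> c \<Longrightarrow> q (c *\<^sub>R x) = c * q x"
    and sublinear_0: "q 0 = 0"
    and sublinear_minus: "- q (- x) \<le> q x"
proof -
  show "q (x + y) \<le> q x + q y" for x y using assms by (simp add: sublinear_def)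
  from this[of x "- x"] show 1: "0 \<le> c \<Longrightarrow> q (c *\<^sub>R x) = c * q x" and 2: "q 0 = 0"
    using assms unfolding sublinear_def by (auto dest: spec[of _ 0])
  show "- q (- x) \<le> q x" using \<open>q (x + - x) \<le> q x + q (- x)\<close> 2 by simp
qed

text \<open>\<open>p x = Inf {q (x + t w) - t q w | t \<ge> 0}\<close> is the largest sublinear functional below \<open>q\<close> that is linear
  with slope \<open>q w\<close> along \<open>w\<close>. It serves twice: a minimal sublinear functional must be odd, since it
  cannot be lowered in this way, and starting from the norm it fixes the value at a chosen vector.\<close>
lemma sublinear_lower:
  assumes q: "sublinear q"
  obtains p where "sublinear p" "p \<le> q" "p (- w) \<le> - q w"
proof
  define S where "S x = (\<lambda>t. q (x + t *\<^sub>R w) - t * q w) ` {0..}" for x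
  define p where "p x = Inf (S x)" for x
  have lb: "- q (- x) \<le> q (x + t *\<^sub>R w) - t * q w" if "0 \<le> t" for x t
    using sublinear_add[OF q, of "x + t *\<^sub>R w" "- x"] sublinear_scale[OF q that, of w] by simp
  have bdd: "bdd_below (S x)" for x unfolding S_def using lb[of _ x] by (meson bdd_belowI2 atLeast_iff)
  have le: "p x \<le> q (x + t *\<^sub>R w) - t * q w" if "0 \<le> t" for x t
    unfolding p_def by (rule cInf_lower[OF _ bdd]) (use that in \<open>simp add: S_def\<close>)
  have ge: "c \<le> p x" if "\<And>t. 0 \<le> t \<Longrightarrow> c \<le> q (x + t *\<^sub>R w) - t * q w" for c x
    unfolding p_def using that by (intro cInf_greatest) (auto simp: S_def)
  show "sublinear p"
  proof (rule sublinearI)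
    fix x y
    have "p (x + y) - p x \<le> p y"
    proof (rule ge)
      fix t :: real assume t: "0 \<le> t"
      have "p (x + y) - (q (y + t *\<^sub>R w) - t * q w) \<le> p x"
      proof (rule ge)
        fix s :: real assume s: "0 \<le> s"
        have "p (x + y) \<le> q ((x + s *\<^sub>R w) + (y + t *\<^sub>R w)) - (s + t) * q w"
          using le[of "s + t" "x + y"] s t by (simp add: algebra_simps)
        also have "\<dots> \<le> q (x + s *\<^sub>R w) + q (y + t *\<^sub>R w) - (s + t) * q w"
          using sublinear_add[OF q] by simp
        finally show "p (x + y) - (q (y + t *\<^sub>R w) - t * q w) \<le> q (x + s *\<^sub>R w) - s * q w"
          by (simp add: algebra_simps)
      qed
      then show "p (x + y) - p x \<le> q (y + t *\<^sub>R w) - t * q w" by simp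
    qed
    then show "p (x + y) \<le> p x + p y" by simp
  next
    show "p 0 \<le> 0" using le[of 0 0] sublinear_0[OF q] by simp
  next
    fix c :: real and x assume c: "0 < c"
    have "p (c *\<^sub>R x) / c \<le> p x"
    proof (rule ge)
      fix t :: real assume t: "0 \<le> t"
      have "p (c *\<^sub>R x) \<le> q (c *\<^sub>R (x + t *\<^sub>R w)) - (c * t) * q w"
        using le[of "c * t" "c *\<^sub>R x"] c t by (simp add: algebra_simps)
      also have "\<dots> = c * (q (x + t *\<^sub>R w) - t * q w)"
        using sublinear_scale[OF q, of c "x + t *\<^sub>R w"] c by (simp add: right_diff_distrib)
      finally show "p (c *\<^sub>R x) / c \<le> q (x + t *\<^sub>R w) - t * q w" using c by (simp add: field_simps)
    qed
    then show "p (c *\<^sub>R x) \<le> c * p x" using c by (simp add: field_simps)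
  qed
  show "p \<le> q" by (rule le_funI) (use le[of 0] in simp)
  show "p (- w) \<le> - q w" using le[of 1 "- w"] sublinear_0[OF q] by simp
qed

text \<open>Zorn's lemma; chains have pointwise infima because \<open>p x\<close> is bounded below by \<open>- q (- x)\<close>.\<close>
lemma sublinear_minimal:
  assumes q: "sublinear q"
  obtains p where "sublinear p" "p \<le> q" "\<And>p'. sublinear p' \<Longrightarrow> p' \<le> p \<Longrightarrow> p' = p"
proof -
  define A where "A = {p. sublinear p \<and> p \<le> q}"
  have "\<exists>m\<in>A. \<forall>a\<in>A. (\<lambda>a b. b \<le> a) m a \<longrightarrow> a = m"
  proof (rule predicate_Zorn)
    show "partial_order_on A (relation_of (\<lambda>a b. b \<le> a) A)"
      by (rule partial_order_on_relation_ofI) auto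
  next
    fix C assume C: "C \<in> Chains (relation_of (\<lambda>a b. b \<le> a) A)"
    have CA: "C \<subseteq> A" using C by (auto simp: Chains_def relation_of_def)
    have tot: "a \<le> b \<or> b \<le> a" if "a \<in> C" "b \<in> C" for a b
      using C that by (auto simp: Chains_def relation_of_def)
    show "\<exists>u\<in>A. \<forall>a\<in>C. u \<le> a"
    proof (cases "C = {}")
      case True
      then show ?thesis using q by (auto simp: A_def)
    next
      case False
      define u where "u x = Inf ((\<lambda>p. p x) ` C)" for x
      have bdd: "bdd_below ((\<lambda>p. p x) ` C)" for x
      proof (rule bdd_belowI2)
        fix p assume "p \<in> C"
        then have p: "sublinear p" "p \<le> q" using CA by (auto simp: A_def)
        show "- q (- x) \<le> p x" using sublinear_minus[OF p(1), of x] le_funD[OF p(2), of "- x"] by simp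
      qed
      have le: "u x \<le> p x" if "p \<in> C" for p x
        unfolding u_def using that by (intro cInf_lower[OF _ bdd]) auto
      have ge: "c \<le> u x" if "\<And>p. p \<in> C \<Longrightarrow> c \<le> p x" for c x
        unfolding u_def using that False by (intro cInf_greatest) auto
      have "sublinear u"
      proof (rule sublinearI)
        fix x y
        have "u (x + y) - u x \<le> u y"
        proof (rule ge)
          fix p1 assume p1: "p1 \<in> C"
          have "u (x + y) - p1 y \<le> u x"
          proof (rule ge)
            fix p2 assume p2: "p2 \<in> C"
            obtain p where p: "p \<in> C" "p \<le> p1" "p \<le> p2" using tot[OF p1 p2] p1 p2 by blast
            then have "sublinear p" using CA by (auto simp: A_def)
            with le[OF p(1), of "x + y"] show "u (x + y) - p1 y \<le> p2 x"
              using sublinear_add[of p x y] le_funD[OF p(2), of y] le_funD[OF p(3), of x] by simp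
          qed
          then show "u (x + y) - u x \<le> p1 y" by simp
        qed
        then show "u (x + y) \<le> u x + u y" by simp
      next
        obtain p where "p \<in> C" using False by blast
        moreover from this have "sublinear p" using CA by (auto simp: A_def)
        ultimately show "u 0 \<le> 0" using le[of p 0] sublinear_0 by force
      next
        fix c :: real and x assume c: "0 < c"
        have "u (c *\<^sub>R x) / c \<le> u x"
        proof (rule ge)
          fix p assume p: "p \<in> C"
          then have "sublinear p" using CA by (auto simp: A_def)
          then show "u (c *\<^sub>R x) / c \<le> p x"
            using le[OF p, of "c *\<^sub>R x"] sublinear_scale[of p c x] c by (simp add: field_simps)
        qed
        then show "u (c *\<^sub>R x) \<le> c * u x" using c by (simp add: field_simps)
      qed
      moreover have "u \<le> q"
      proof -
        obtain p where p: "p \<in> C" using False by blast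
        then have "p \<le> q" using CA by (auto simp: A_def)
        with le[OF p] show ?thesis by (meson le_fun_def order_trans)
      qed
      ultimately show ?thesis using le by (auto simp: A_def le_fun_def)
    qed
  qed
  then obtain m where "m \<in> A" "\<forall>a\<in>A. a \<le> m \<longrightarrow> a = m" by blast
  then show thesis using that[of m] by (auto simp: A_def intro: order_trans)
qed

text \<open>The Hahn-Banach theorem in the form needed here. A minimal sublinear functional is linear, so the
  proof works with everywhere defined functionals only and never extends from a subspace.\<close>
lemma norming_functional:
  fixes w :: "'a::real_normed_vector"
  obtains g :: "'a \<Rightarrow>\<^sub>L real" where "norm g \<le> 1" "blinfun_apply g w = norm w"
proof -
  have "sublinear (norm :: 'a \<Rightarrow> real)" by (simp add: sublinear_def norm_triangle_ineq)
  then obtain q where q: "sublinear q" "q \<le> norm" "q (- w) \<le> - norm w" by (rule sublinear_lower)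
  obtain p where p: "sublinear p" "p \<le> q" and min: "\<And>p'. sublinear p' \<Longrightarrow> p' \<le> p \<Longrightarrow> p' = p"
    using sublinear_minimal[OF q(1)] by metis
  have odd: "p (- x) = - p x" for x
  proof -
    \<comment> \<open>minimality: lowering \<open>p\<close> along \<open>x\<close> changes nothing\<close>
    obtain p' where "sublinear p'" "p' \<le> p" "p' (- x) \<le> - p x" using sublinear_lower[OF p(1)] by metis
    then show ?thesis using min sublinear_minus[OF p(1), of x] by force
  qed
  have le: "p x \<le> norm x" for x using p(2) q(2) by (meson le_fun_def order_trans)
  have "bounded_linear p"
  proof (rule bounded_linear_intro)
    fix x y
    have "p (- x + - y) \<le> p (- x) + p (- y)" by (rule sublinear_add[OF p(1)])
    moreover have "- x + - y = - (x + y)" by simp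
    ultimately have "- p (x + y) \<le> - p x + - p y" by (simp only: odd)
    then show "p (x + y) = p x + p y" using sublinear_add[OF p(1), of x y] by simp
  next
    fix c :: real and x
    show "p (c *\<^sub>R x) = c *\<^sub>R p x"
    proof (cases "0 \<le> c")
      case False
      then have "p ((- c) *\<^sub>R x) = - c * p x" using sublinear_scale[OF p(1), of "- c" x] by simp
      then show ?thesis using odd[of "c *\<^sub>R x"] by simp
    qed (simp add: sublinear_scale[OF p(1)])
  next
    fix x show "norm (p x) \<le> norm x * 1" using le[of x] le[of "- x"] by (simp add: odd)
  qed
  then have app: "blinfun_apply (Blinfun p) = p" by (rule bounded_linear_Blinfun_apply)
  have "norm (Blinfun p) \<le> 1"
    by (rule norm_blinfun_bound) (use le le[of "- _"] in \<open>auto simp: app odd abs_le_iff\<close>)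
  moreover have "p w = norm w"
    using le[of w] odd[of w] le_funD[OF p(2), of "- w"] q(3) by simp
  ultimately show thesis using that[of "Blinfun p"] by (simp add: app)
qed

text \<open>The Banach-Steinhaus theorem for nonlinear \<open>\<Phi>\<close> with a quasi-triangle inequality. It covers both
  \<open>\<bar>f n x\<bar>\<close>, as a function of \<open>x\<close>, and the partial sums of \<open>\<bar>g (x n)\<bar> powr p\<close>, as a function of \<open>g\<close>. By
  Baire's theorem some sublevel set contains a ball, and the inequality moves this ball to 0.\<close>
lemma uniform_boundedness:
  fixes \<Phi> :: "'i \<Rightarrow> 'a::banach \<Rightarrow> real"
  assumes cont: "\<And>i. continuous_on UNIV (\<Phi> i)"
    and bound: "\<And>x. \<exists>M. \<forall>i. \<Phi> i x \<le> M"
    and diff: "\<And>i x y. \<Phi> i (x - y) \<le> C * (\<Phi> i x + \<Phi> i y)" and C: "0 \<le> C"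
  shows "\<exists>r>0. \<exists>K. \<forall>i x. norm x < r \<longrightarrow> \<Phi> i x \<le> K"
proof -
  define F where "F n = {x. \<forall>i. \<Phi> i x \<le> real n}" for n
  have closed: "closed (F n)" for n
  proof -
    have "F n = (\<Inter>i. {x. \<Phi> i x \<le> real n})" by (auto simp: F_def)
    moreover have "closed {x. \<Phi> i x \<le> real n}" for i
      using cont by (intro closed_Collect_le) auto
    ultimately show ?thesis by auto
  qed
  have "(\<Union>n. F n) = UNIV"
  proof (intro equalityI subsetI UNIV_I)
    fix x
    obtain M where M: "\<forall>i. \<Phi> i x \<le> M" using bound by blast
    obtain n where "M \<le> real n" using real_arch_simple by blast
    with M have "x \<in> F n" unfolding F_def using order_trans by blast
    then show "x \<in> (\<Union>n. F n)" by blast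
  qed
  have "\<exists>n. interior (F n) \<noteq> {}"
  proof (rule ccontr)
    assume "\<not> ?thesis"
    then have "euclidean interior_of \<Union> (range F) = {}"
      using closed by (intro Baire_category_alt) (auto simp: completely_metrizable_space_euclidean)
    then show False using \<open>(\<Union>n. F n) = UNIV\<close> by auto
  qed
  then obtain n x0 e where e: "0 < e" "ball x0 e \<subseteq> F n" by (force simp: mem_interior)
  show ?thesis
  proof (intro exI conjI allI impI)
    fix i and x :: 'a assume "norm x < e"
    then have "x0 + x \<in> F n" "x0 \<in> F n" using e by (auto simp: dist_norm subset_iff)
    then have "\<Phi> i (x0 + x) \<le> n" "\<Phi> i x0 \<le> n" unfolding F_def by blast+
    then have "C * (\<Phi> i (x0 + x) + \<Phi> i x0) \<le> C * (real n + real n)"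
      using C by (intro mult_left_mono add_mono)
    then show "\<Phi> i x \<le> C * (real n + real n)" using diff[of i "x0 + x" x0] by simp
  qed (rule e)
qed

lemma norm_le_of_bounded_on_ball:
  fixes f :: "'a::real_normed_vector \<Rightarrow>\<^sub>L real"
  assumes r: "0 < r" and K: "\<And>x. norm x < r \<Longrightarrow> \<bar>blinfun_apply f x\<bar> \<le> K"
  shows "norm f \<le> 2 * K / r"
proof (rule norm_blinfun_bound)
  have "0 \<le> K" using K[of 0] r by simp
  then show "0 \<le> 2 * K / r" using r by simp
  fix x
  show "norm (blinfun_apply f x) \<le> 2 * K / r * norm x"
  proof (cases "x = 0")
    case False
    have "\<bar>blinfun_apply f ((r / (2 * norm x)) *\<^sub>R x)\<bar> \<le> K" using False r by (intro K) simp
    then show ?thesis using False r by (simp add: blinfun.scaleR_right abs_mult field_simps)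
  qed simp
qed

lemma weak_star_null_bounded:
  fixes f :: "nat \<Rightarrow> ('a::banach \<Rightarrow>\<^sub>L real)"
  assumes "weak_star_null f"
  obtains M where "\<And>n. norm (f n) \<le> M"
proof -
  have "\<exists>r>0. \<exists>K. \<forall>n x. norm x < r \<longrightarrow> \<bar>blinfun_apply (f n) x\<bar> \<le> K"
  proof (rule uniform_boundedness)
    fix x
    have "Bseq (\<lambda>n. blinfun_apply (f n) x)"
      using assms by (auto simp: weak_star_null_def intro!: convergent_imp_Bseq convergentI)
    then show "\<exists>M. \<forall>n. \<bar>blinfun_apply (f n) x\<bar> \<le> M" by (auto simp: Bseq_def)
  next
    fix n and x y :: 'a
    show "\<bar>blinfun_apply (f n) (x - y)\<bar> \<le> 1 * (\<bar>blinfun_apply (f n) x\<bar> + \<bar>blinfun_apply (f n) y\<bar>)"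
      by (simp add: blinfun.diff_right)
  qed (auto intro!: continuous_intros)
  then show thesis using norm_le_of_bounded_on_ball that by metis
qed

section \<open>Subsequences\<close>

text \<open>A relation that holds for arbitrarily large \<open>n\<close>, but only finitely often for each \<open>k\<close>, must use
  arbitrarily large \<open>k\<close> as well.\<close>
lemma strict_mono_selection:
  assumes ex: "\<And>N. \<exists>n\<ge>N. \<exists>k. P n k" and ev: "\<And>k. eventually (\<lambda>n. \<not> P n k) sequentially"
  obtains r s :: "nat \<Rightarrow> nat" where "strict_mono r" "strict_mono s" "\<And>j. P (r j) (s j)"
proof -
  have step: "\<exists>z'. P (fst z') (snd z') \<and> n < fst z' \<and> k < snd z'" for n k
  proof -
    have "eventually (\<lambda>n. \<forall>i\<in>{..k}. \<not> P n i) sequentially"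
      using ev by (intro eventually_ball_finite) auto
    then obtain N where N: "\<And>m i. N \<le> m \<Longrightarrow> i \<le> k \<Longrightarrow> \<not> P m i"
      by (auto simp: eventually_sequentially)
    obtain n' k' where "max N (Suc n) \<le> n'" "P n' k'" using ex by blast
    then show ?thesis using N[of n' k'] by (intro exI[of _ "(n', k')"]) (auto simp: not_le[symmetric])
  qed
  have "\<exists>h. \<forall>j. P (fst (h j)) (snd (h j)) \<and> fst (h j) < fst (h (Suc j)) \<and> snd (h j) < snd (h (Suc j))"
    by (rule dependent_nat_choice) (use step in blast)+
  then obtain h where "\<And>j. P (fst (h j)) (snd (h j))" "\<And>j. fst (h j) < fst (h (Suc j))"
    "\<And>j. snd (h j) < snd (h (Suc j))" by blast
  then show thesis using that[of "fst \<circ> h" "snd \<circ> h"] by (simp add: strict_mono_Suc_iff)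
qed

lemma strict_mono_dependent_selection:
  assumes "\<And>m. eventually (Q m) sequentially"
  obtains r :: "nat \<Rightarrow> nat" where "strict_mono r" "\<And>j. Q (r j) (r (Suc j))"
proof -
  have "\<exists>n'. True \<and> (n < n' \<and> Q n n')" for n
    using eventually_conj[OF assms[of n] eventually_gt_at_top[of n]]
    by (metis (mono_tags, lifting) eventually_sequentially order_refl)
  then have "\<exists>r. \<forall>j. True \<and> (r j < r (Suc j) \<and> Q (r j) (r (Suc j)))"
    by (intro dependent_nat_choice) auto
  then show thesis using that by (auto simp: strict_mono_Suc_iff)
qed

lemma not_tendsto_0_subseq:
  fixes a :: "nat \<Rightarrow> real"
  assumes "\<not> a \<longlonglongrightarrow> 0"
  obtains e and r :: "nat \<Rightarrow> nat" where "0 < e" "strict_mono r" "\<And>n. e \<le> \<bar>a (r n)\<bar>"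
proof -
  obtain e where e: "0 < e" "\<And>N. \<exists>n\<ge>N. \<not> \<bar>a n\<bar> < e"
    using assms by (auto simp: LIMSEQ_iff)
  then have "infinite {n. e \<le> \<bar>a n\<bar>}" by (auto simp: infinite_nat_iff_unbounded_le not_less)
  then obtain r :: "nat \<Rightarrow> nat" where "strict_mono r" "\<And>n. r n \<in> {n. e \<le> \<bar>a n\<bar>}"
    using infinite_enumerate by blast
  with e that show thesis by auto
qed

lemma weak_star_null_subseq:
  "weak_star_null f \<Longrightarrow> strict_mono r \<Longrightarrow> weak_star_null (\<lambda>n. f (r n))"
  unfolding weak_star_null_def by (auto dest: LIMSEQ_subseq_LIMSEQ[unfolded o_def])

section \<open>Phillips' lemma\<close>

text \<open>The set \<open>J\<close> splits into infinitely many disjoint infinite pieces. If each contained a set of measure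
  larger than \<open>e\<close> in absolute value, the total variation would be infinite.\<close>
lemma finitely_additive_small_tail:
  fixes \<mu> :: "nat set \<Rightarrow> real"
  assumes add: "\<And>A B. A \<inter> B = {} \<Longrightarrow> \<mu> (A \<union> B) = \<mu> A + \<mu> B"
    and bdd: "\<And>A. \<bar>\<mu> A\<bar> \<le> C" and J: "infinite J" and e: "0 < e"
  shows "\<exists>J'\<subseteq>J. infinite J' \<and> (\<forall>A\<subseteq>J'. \<bar>\<mu> A\<bar> \<le> e)"
proof (rule ccontr)
  assume "\<not> ?thesis"
  then have big: "\<exists>A\<subseteq>J'. e < \<bar>\<mu> A\<bar>" if "J' \<subseteq> J" "infinite J'" for J'
    using that by (meson not_le)
  define I where "I i = range (\<lambda>k. enumerate J (prod_encode (i, k)))" for i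
  \<comment> \<open>the pieces are the images of the rows of the pairing bijection\<close>
  have inj: "inj (enumerate J)" using J by (rule strict_mono_imp_inj_on[OF strict_mono_enumerate])
  have sub: "I i \<subseteq> J" for i using J by (auto simp: I_def enumerate_in_set)
  have inf: "infinite (I i)" for i
    unfolding I_def by (intro range_inj_infinite injI) (auto dest!: injD[OF inj])
  have disj: "I i \<inter> I j = {}" if "i \<noteq> j" for i j
    using that by (auto simp: I_def dest!: injD[OF inj])
  obtain A where A: "\<And>i. A i \<subseteq> I i" "\<And>i. e < \<bar>\<mu> (A i)\<bar>"
    using big[OF sub inf] by metis
  have m0: "\<mu> {} = 0" using add[of "{}" "{}"] by simp
  have sum: "\<mu> (\<Union>i\<in>P. A i) = (\<Sum>i\<in>P. \<mu> (A i))" if "finite P" for P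
    using that
  proof induction
    case (insert i P)
    have "A i \<inter> (\<Union>i\<in>P. A i) = {}"
      using A(1) disj insert(2) by (simp add: disjoint_iff) (metis subsetD)
    then show ?case using insert add by simp
  qed (simp add: m0)
  have abs: "(\<Sum>i<N. \<bar>\<mu> (A i)\<bar>) \<le> 2 * C" for N
  proof -
    let ?P = "{i\<in>{..<N}. 0 \<le> \<mu> (A i)}" and ?M = "{i\<in>{..<N}. \<not> 0 \<le> \<mu> (A i)}"
    have "(\<Sum>i<N. \<bar>\<mu> (A i)\<bar>) = (\<Sum>i\<in>?P \<union> ?M. \<bar>\<mu> (A i)\<bar>)" by (intro sum.cong) auto
    also have "\<dots> = (\<Sum>i\<in>?P. \<bar>\<mu> (A i)\<bar>) + (\<Sum>i\<in>?M. \<bar>\<mu> (A i)\<bar>)"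
      by (intro sum.union_disjoint) auto
    also have "\<dots> = (\<Sum>i\<in>?P. \<mu> (A i)) + (\<Sum>i\<in>?M. - \<mu> (A i))"
      by (intro arg_cong2[where f = "(+)"] sum.cong) auto
    also have "\<dots> = \<mu> (\<Union>i\<in>?P. A i) - \<mu> (\<Union>i\<in>?M. A i)"
      by (simp add: sum sum_negf)
    also have "\<dots> \<le> 2 * C"
      using bdd[of "\<Union>i\<in>?P. A i"] bdd[of "\<Union>i\<in>?M. A i"] by linarith
    finally show ?thesis .
  qed
  obtain N where N: "2 * C < real N * e" using reals_Archimedean3[OF e] by blast
  have "real N * e \<le> (\<Sum>i<N. \<bar>\<mu> (A i)\<bar>)"
    using sum_mono[of "{..<N}" "\<lambda>_. e" "\<lambda>i. \<bar>\<mu> (A i)\<bar>"] A(2) by (simp add: less_imp_le)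
  with abs[of N] N show False by simp
qed

text \<open>Gliding hump. If \<open>\<bar>\<mu> n {n}\<bar> \<ge> e\<close> for infinitely many \<open>n\<close>, indices \<open>n 0 < n 1 < ...\<close> are chosen among
  these together with decreasing infinite sets from which all later indices are taken. For the set \<open>M\<close>
  of all chosen indices, the earlier part of \<open>M\<close> has small measure for \<open>\<mu> (n j)\<close> by the convergence to
  0 on finite sets, the later part by \<open>finitely_additive_small_tail\<close>. So \<open>\<mu> (n j) M\<close> stays away from 0.\<close>
lemma phillips_lemma:
  fixes \<mu> :: "nat \<Rightarrow> nat set \<Rightarrow> real"
  assumes add: "\<And>n A B. A \<inter> B = {} \<Longrightarrow> \<mu> n (A \<union> B) = \<mu> n A + \<mu> n B"
    and bdd: "\<And>n A. \<bar>\<mu> n A\<bar> \<le> C n" and null: "\<And>A. (\<lambda>n. \<mu> n A) \<longlonglongrightarrow> 0"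
  shows "(\<lambda>n. \<mu> n {n}) \<longlonglongrightarrow> 0"
proof (rule ccontr)
  assume "\<not> ?thesis"
  then obtain e and r :: "nat \<Rightarrow> nat"
    where e: "0 < e" and r: "strict_mono r" "\<And>n. e \<le> \<bar>\<mu> (r n) {r n}\<bar>"
    by (rule not_tendsto_0_subseq) blast
  define I where "I = range r"
  have I: "infinite I" "\<And>n. n \<in> I \<Longrightarrow> e \<le> \<bar>\<mu> n {n}\<bar>"
    using r by (auto simp: I_def range_inj_infinite strict_mono_imp_inj_on)
  \<comment> \<open>a state consists of the index chosen last and the set that contains all later choices\<close>
  define ok where "ok z \<longleftrightarrow> fst z \<in> I \<and> snd z \<subseteq> I \<inter> {fst z<..} \<and> infinite (snd z) \<and>
      (\<forall>A\<subseteq>snd z. \<bar>\<mu> (fst z) A\<bar> \<le> e / 4)" for z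
  have tail: "\<exists>J'. J' \<subseteq> J \<and> ok (n, J')" if "n \<in> I" "J \<subseteq> I" "infinite J" for n J
  proof -
    have inf: "infinite (J \<inter> {n<..})"
    proof -
      have "J \<inter> {n<..} = J - {..n}" by auto
      with that(3) show ?thesis by (simp add: Diff_infinite_finite)
    qed
    have e4: "0 < e / 4" using e by simp
    have "\<exists>J'\<subseteq>J \<inter> {n<..}. infinite J' \<and> (\<forall>A\<subseteq>J'. \<bar>\<mu> n A\<bar> \<le> e / 4)"
      by (rule finitely_additive_small_tail[of "\<mu> n" "C n", OF _ bdd inf e4]) (rule add)
    then obtain J' where J': "J' \<subseteq> J \<inter> {n<..}" "infinite J'" "\<forall>A\<subseteq>J'. \<bar>\<mu> n A\<bar> \<le> e / 4"
      by blast
    then have "ok (n, J')" unfolding ok_def fst_conv snd_conv using that by blast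
    with J'(1) show ?thesis by blast
  qed
  have step: "\<exists>z'. ok z' \<and> (fst z' \<in> snd z \<and> snd z' \<subseteq> snd z \<and> (\<forall>B\<subseteq>{..fst z}. \<bar>\<mu> (fst z') B\<bar> \<le> e / 4))"
    if z: "ok z" for z
  proof -
    have "eventually (\<lambda>n. \<forall>B\<in>Pow {..fst z}. \<bar>\<mu> n B\<bar> \<le> e / 4) sequentially"
    proof (intro eventually_ball_finite ballI)
      fix B
      have "eventually (\<lambda>n. \<bar>\<mu> n B\<bar> < e / 4) sequentially"
        using order_tendstoD(2)[OF tendsto_rabs_zero[OF null[of B]], of "e / 4"] e by simp
      then show "eventually (\<lambda>n. \<bar>\<mu> n B\<bar> \<le> e / 4) sequentially" by eventually_elim simp
    qed simp
    then obtain N where N: "\<And>n B. N \<le> n \<Longrightarrow> B \<subseteq> {..fst z} \<Longrightarrow> \<bar>\<mu> n B\<bar> \<le> e / 4"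
      by (auto simp: eventually_sequentially)
    have z': "infinite (snd z)" "snd z \<subseteq> I" using z unfolding ok_def by blast+
    then obtain n where n: "n \<in> snd z" "N \<le> n"
      unfolding infinite_nat_iff_unbounded_le by blast
    then obtain J' where J': "J' \<subseteq> snd z" "ok (n, J')"
      using tail[of n "snd z"] z' by blast
    show ?thesis
    proof (intro exI conjI allI impI)
      show "ok (n, J')" by fact
    qed (use n J' N in simp_all)
  qed
  obtain n0 where "n0 \<in> I" using I(1) unfolding I_def by blast
  then obtain z0 where "ok z0" using tail[of n0 I] I(1) by blast
  then have "\<exists>z. \<forall>j. ok (z j) \<and> (fst (z (Suc j)) \<in> snd (z j) \<and> snd (z (Suc j)) \<subseteq> snd (z j) \<and>
      (\<forall>B\<subseteq>{..fst (z j)}. \<bar>\<mu> (fst (z (Suc j))) B\<bar> \<le> e / 4))"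
  proof (intro dependent_nat_choice)
    show "\<exists>z. ok z" using \<open>ok z0\<close> ..
  qed (rule step)
  then obtain z where z: "\<And>j. ok (z j)"
    "\<And>j. fst (z (Suc j)) \<in> snd (z j) \<and> snd (z (Suc j)) \<subseteq> snd (z j) \<and>
      (\<forall>B\<subseteq>{..fst (z j)}. \<bar>\<mu> (fst (z (Suc j))) B\<bar> \<le> e / 4)"
    by blast
  define n where "n j = fst (z j)" for j
  define M where "M = range n"
  have ok: "n j \<in> I" "snd (z j) \<subseteq> {n j<..}" "A \<subseteq> snd (z j) \<Longrightarrow> \<bar>\<mu> (n j) A\<bar> \<le> e / 4" for j A
  proof -
    have "ok (z j)" by (rule z(1))
    then show "n j \<in> I" "snd (z j) \<subseteq> {n j<..}" "A \<subseteq> snd (z j) \<Longrightarrow> \<bar>\<mu> (n j) A\<bar> \<le> e / 4"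
      unfolding ok_def n_def by (simp_all only: le_inf_iff)
  qed
  have succ: "n (Suc j) \<in> snd (z j)" "snd (z (Suc j)) \<subseteq> snd (z j)"
    "B \<subseteq> {..n j} \<Longrightarrow> \<bar>\<mu> (n (Suc j)) B\<bar> \<le> e / 4" for j B
    using z(2)[of j] unfolding n_def by simp_all
  have later: "n i \<in> snd (z j)" if "j < i" for i j
  proof -
    have "snd (z (i - 1)) \<subseteq> snd (z j)"
      by (rule lift_Suc_antimono_le[of "\<lambda>i. snd (z i)", OF succ(2)]) (use that in simp)
    moreover have "n i \<in> snd (z (i - 1))" using succ(1)[of "i - 1"] that by simp
    ultimately show ?thesis by blast
  qed
  have mono: "strict_mono n"
    using succ(1) ok(2) unfolding strict_mono_Suc_iff by blast
  have "e / 2 \<le> \<bar>\<mu> (n (Suc j)) M\<bar>" for j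
  proof -
    let ?B = "n ` {..j}" and ?T = "n ` {Suc j<..}"
    have "M = ?B \<union> ({n (Suc j)} \<union> ?T)"
    proof -
      have "(UNIV::nat set) = {..j} \<union> ({Suc j} \<union> {Suc j<..})" by auto
      then have "range n = n ` ({..j} \<union> ({Suc j} \<union> {Suc j<..}))" by (rule arg_cong)
      then show ?thesis unfolding M_def by (simp only: image_Un image_insert image_empty)
    qed
    moreover have "?B \<inter> ({n (Suc j)} \<union> ?T) = {}" "{n (Suc j)} \<inter> ?T = {}"
      using mono by (auto simp: strict_mono_eq)
    ultimately have "\<mu> (n (Suc j)) M = \<mu> (n (Suc j)) ?B + (\<mu> (n (Suc j)) {n (Suc j)} + \<mu> (n (Suc j)) ?T)"
      by (simp only: add)
    moreover have "\<bar>\<mu> (n (Suc j)) ?B\<bar> \<le> e / 4"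
    proof -
      have "?B \<subseteq> {..n j}" using mono by (auto simp: strict_mono_less_eq)
      then show ?thesis by (rule succ(3))
    qed
    moreover have "\<bar>\<mu> (n (Suc j)) ?T\<bar> \<le> e / 4"
    proof -
      have "?T \<subseteq> snd (z (Suc j))" using later by auto
      then show ?thesis by (rule ok(3))
    qed
    moreover have "e \<le> \<bar>\<mu> (n (Suc j)) {n (Suc j)}\<bar>"
      using ok(1) by (rule I(2))
    ultimately show ?thesis by linarith
  qed
  moreover have "(\<lambda>j. \<bar>\<mu> (n (Suc j)) M\<bar>) \<longlonglongrightarrow> 0"
    using LIMSEQ_subseq_LIMSEQ[OF null[of M], of "n \<circ> Suc"] mono
    by (auto simp: o_def strict_mono_def intro: tendsto_rabs_zero)
  ultimately have "e / 2 \<le> 0" by (intro LIMSEQ_le_const) auto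
  with e show False by simp
qed

section \<open>Disjoint sequences in order intervals\<close>

lemma sigma_dedekind_complete_Sup:
  fixes A :: "'a::banach_lattice set"
  assumes "sigma_dedekind_complete TYPE('a)" "countable A" "A \<noteq> {}" "\<And>a. a \<in> A \<Longrightarrow> a \<le> b"
  shows "\<exists>s. (\<forall>a\<in>A. a \<le> s) \<and> (\<forall>u. (\<forall>a\<in>A. a \<le> u) \<longrightarrow> s \<le> u)"
proof -
  have "bdd_above A" using assms(4) by (rule bdd_aboveI)
  with assms(1-3) show ?thesis unfolding sigma_dedekind_complete_def by simp
qed

text \<open>\<open>Z A\<close> is the supremum of \<open>z k\<close> for \<open>k \<in> A\<close>. Suprema over disjoint index sets are disjoint vectors, so the
  supremum of both is their sum.\<close>
lemma disjoint_suprema_additive: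
  fixes z :: "nat \<Rightarrow> 'a::banach_lattice"
  assumes sdc: "sigma_dedekind_complete TYPE('a)"
    and pos: "\<And>k. 0 \<le> z k" and le: "\<And>k. z k \<le> x" and dis: "\<And>j k. j \<noteq> k \<Longrightarrow> inf (z j) (z k) = 0"
  shows "\<exists>Z. (\<forall>A B. A \<inter> B = {} \<longrightarrow> Z (A \<union> B) = Z A + Z B) \<and> (\<forall>A. 0 \<le> Z A) \<and> (\<forall>A. Z A \<le> x) \<and>
    (\<forall>k. Z {k} = z k)"
proof -
  have x: "0 \<le> x" using pos[of 0] le[of 0] by (rule order_trans)
  have ex: "\<exists>s. (\<forall>a\<in>insert 0 (z ` A). a \<le> s) \<and> (\<forall>u. (\<forall>a\<in>insert 0 (z ` A). a \<le> u) \<longrightarrow> s \<le> u)" for A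
    by (rule sigma_dedekind_complete_Sup[OF sdc, of _ x]) (use x le in auto)
  \<comment> \<open>0 is inserted so that the supremum over the empty set is 0\<close>
  define Z where "Z A = (SOME s. (\<forall>a\<in>insert 0 (z ` A). a \<le> s) \<and>
      (\<forall>u. (\<forall>a\<in>insert 0 (z ` A). a \<le> u) \<longrightarrow> s \<le> u))" for A
  have Z: "(\<forall>a\<in>insert 0 (z ` A). a \<le> Z A) \<and> (\<forall>u. (\<forall>a\<in>insert 0 (z ` A). a \<le> u) \<longrightarrow> Z A \<le> u)" for A
    unfolding Z_def by (rule someI_ex[OF ex])
  have ub: "z k \<le> Z A" if "k \<in> A" for k A using Z[of A] that by simp
  have pos': "0 \<le> Z A" for A using Z[of A] by simp
  have lub: "Z A \<le> u" if "0 \<le> u" "\<And>k. k \<in> A \<Longrightarrow> z k \<le> u" for A u using Z[of A] that by simp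
  have mono: "Z A \<le> Z B" if "A \<subseteq> B" for A B using that by (intro lub pos' ub) auto
  have dZ: "inf a (Z A) = 0" if "0 \<le> a" "\<And>k. k \<in> A \<Longrightarrow> inf a (z k) = 0" for a A
  proof (rule disjoint_Sup[of "insert 0 (z ` A)"])
    show "inf a v = 0" if "v \<in> insert 0 (z ` A)" for v
      using that \<open>0 \<le> a\<close> \<open>\<And>k. k \<in> A \<Longrightarrow> inf a (z k) = 0\<close> by (auto simp: inf_absorb2)
    show "v \<le> Z A" if "v \<in> insert 0 (z ` A)" for v using that ub pos' by auto
    show "Z A \<le> u" if "\<And>v. v \<in> insert 0 (z ` A) \<Longrightarrow> v \<le> u" for u using that by (intro lub) auto
  qed (use that pos' in auto)
  have disZ: "inf (Z A) (Z B) = 0" if "A \<inter> B = {}" for A B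
  proof (rule dZ[OF pos'])
    fix k assume k: "k \<in> B"
    have "inf (z k) (Z A) = 0"
    proof (rule dZ[OF pos])
      show "inf (z k) (z j) = 0" if "j \<in> A" for j using dis[of k j] that k \<open>A \<inter> B = {}\<close> by blast
    qed
    then show "inf (Z A) (z k) = 0" by (simp only: inf_commute)
  qed
  show ?thesis
  proof (intro exI[of _ Z] conjI allI impI)
    show "Z (A \<union> B) = Z A + Z B" if "A \<inter> B = {}" for A B
    proof (rule antisym)
      show "Z A + Z B \<le> Z (A \<union> B)"
        using disZ[OF that] by (rule disjoint_add_le) (auto intro: mono)
      show "Z (A \<union> B) \<le> Z A + Z B"
      proof (rule lub)
        fix k assume "k \<in> A \<union> B"
        then consider "z k \<le> Z A" | "z k \<le> Z B" using ub by blast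
        then show "z k \<le> Z A + Z B"
          by cases (use pos' in \<open>auto intro: order_trans add_increasing add_increasing2\<close>)
      qed (intro add_nonneg_nonneg pos')
    qed
    show "Z A \<le> x" for A using x le by (rule lub)
    show "Z {k} = z k" for k
      by (rule antisym) (auto intro: lub ub pos)
  qed (rule pos')
qed

text \<open>Phillips' lemma applied to \<open>\<mu> n A = g n (Z A)\<close>, where \<open>Z A\<close> is the supremum of the \<open>z k\<close> with \<open>k \<in> A\<close>.\<close>
lemma weak_star_null_disjoint_order_bounded:
  fixes z :: "nat \<Rightarrow> 'a::banach_lattice"
  assumes sdc: "sigma_dedekind_complete TYPE('a)" and g: "weak_star_null g"
    and pos: "\<And>k. 0 \<le> z k" and le: "\<And>k. z k \<le> x" and dis: "\<And>j k. j \<noteq> k \<Longrightarrow> inf (z j) (z k) = 0"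
  shows "(\<lambda>n. blinfun_apply (g n) (z n)) \<longlonglongrightarrow> 0"
proof -
  obtain Z where Z: "\<And>A B. A \<inter> B = {} \<Longrightarrow> Z (A \<union> B) = Z A + Z B" "\<And>A. 0 \<le> Z A" "\<And>A. Z A \<le> x"
    "\<And>k. Z {k} = z k"
    using disjoint_suprema_additive[of z x, OF sdc pos le dis] by auto
  have "(\<lambda>n. blinfun_apply (g n) (Z {n})) \<longlonglongrightarrow> 0"
  proof (rule phillips_lemma)
    show "blinfun_apply (g n) (Z (A \<union> B)) = blinfun_apply (g n) (Z A) + blinfun_apply (g n) (Z B)"
      if "A \<inter> B = {}" for n A B using Z(1)[OF that] by (simp add: blinfun.add_right)
    show "\<bar>blinfun_apply (g n) (Z A)\<bar> \<le> norm (g n) * norm x" for n A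
      using norm_blinfun[of "g n" "Z A"] mult_left_mono[OF norm_mono_pos[OF Z(2)[of A] Z(3)], of "norm (g n)"]
      by simp
    show "(\<lambda>n. blinfun_apply (g n) (Z A)) \<longlonglongrightarrow> 0" for A
      using g by (simp add: weak_star_null_def)
  qed
  then show ?thesis by (simp add: Z(4))
qed

section \<open>Principal band projections\<close>

text \<open>Only the values on the positive cone are prescribed, by \<open>P x = sup n. inf x (n y)\<close>; linear functionals
  are recovered from them by \<open>cone_additive_extension\<close>.\<close>
definition is_band_projection :: "'a::banach_lattice \<Rightarrow> ('a \<Rightarrow> 'a) \<Rightarrow> bool" where
  "is_band_projection y P \<longleftrightarrow>
     (\<forall>x\<ge>0. (\<forall>n. inf x (real n *\<^sub>R y) \<le> P x) \<and> (\<forall>u. (\<forall>n. inf x (real n *\<^sub>R y) \<le> u) \<longrightarrow> P x \<le> u))"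

lemma band_projection_exists:
  fixes y :: "'a::banach_lattice"
  assumes "sigma_dedekind_complete TYPE('a)"
  shows "\<exists>P. is_band_projection y P"
proof -
  have ex: "\<exists>s. (\<forall>n. inf x (real n *\<^sub>R y) \<le> s) \<and> (\<forall>u. (\<forall>n. inf x (real n *\<^sub>R y) \<le> u) \<longrightarrow> s \<le> u)" for x
  proof -
    let ?A = "range (\<lambda>n. inf x (real n *\<^sub>R y))"
    have "\<exists>s. (\<forall>a\<in>?A. a \<le> s) \<and> (\<forall>u. (\<forall>a\<in>?A. a \<le> u) \<longrightarrow> s \<le> u)"
      by (rule sigma_dedekind_complete_Sup[OF assms, of _ x]) auto
    then show ?thesis by simp
  qed
  define P where "P x = (SOME s. (\<forall>n. inf x (real n *\<^sub>R y) \<le> s) \<and> (\<forall>u. (\<forall>n. inf x (real n *\<^sub>R y) \<le> u) \<longrightarrow> s \<le> u))" for x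
  have "(\<forall>n. inf x (real n *\<^sub>R y) \<le> P x) \<and> (\<forall>u. (\<forall>n. inf x (real n *\<^sub>R y) \<le> u) \<longrightarrow> P x \<le> u)" for x
    unfolding P_def by (rule someI_ex[OF ex])
  then have "is_band_projection y P" unfolding is_band_projection_def by blast
  then show ?thesis by (rule exI[of _ P])
qed

context
  fixes y :: "'a::banach_lattice" and P
  assumes y: "0 \<le> y" and P: "is_band_projection y P"
begin

lemma band_projection_upper: "0 \<le> x \<Longrightarrow> inf x (real n *\<^sub>R y) \<le> P x"
  using P by (simp add: is_band_projection_def)

lemma band_projection_least: "0 \<le> x \<Longrightarrow> (\<And>n. inf x (real n *\<^sub>R y) \<le> u) \<Longrightarrow> P x \<le> u"
  using P by (simp add: is_band_projection_def)

lemma band_projection_nonneg: "0 \<le> x \<Longrightarrow> 0 \<le> P x"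
  using band_projection_upper[of x 0] by (simp add: inf_absorb2)

lemma band_projection_le: "0 \<le> x \<Longrightarrow> P x \<le> x"
  by (rule band_projection_least) auto

lemma band_projection_id: "0 \<le> v \<Longrightarrow> v \<le> y \<Longrightarrow> P v = v"
  using band_projection_upper[of v 1] band_projection_le[of v] by (simp add: inf_absorb1)

lemma band_projection_add:
  assumes a: "0 \<le> a" and b: "0 \<le> b"
  shows "P (a + b) = P a + P b"
proof (rule antisym)
  have ab: "0 \<le> a + b" using a b by (rule add_nonneg_nonneg)
  show "P (a + b) \<le> P a + P b"
  proof (rule band_projection_least[OF ab])
    fix n
    have "inf (a + b) (real n *\<^sub>R y) \<le> inf a (real n *\<^sub>R y) + inf b (real n *\<^sub>R y)"
      using a b y by (intro inf_add_le) (auto intro: scaleR_nonneg_nonneg)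
    also have "\<dots> \<le> P a + P b" using a b by (intro add_mono band_projection_upper)
    finally show "inf (a + b) (real n *\<^sub>R y) \<le> P a + P b" .
  qed
  have "P b \<le> P (a + b) - P a"
  proof (rule band_projection_least[OF b])
    fix m
    have "P a \<le> P (a + b) - inf b (real m *\<^sub>R y)"
    proof (rule band_projection_least[OF a])
      fix n
      have "inf a (real n *\<^sub>R y) + inf b (real m *\<^sub>R y) \<le> inf (a + b) (real (n + m) *\<^sub>R y)"
        by (intro le_infI) (auto simp: scaleR_left_distrib intro!: add_mono)
      also have "\<dots> \<le> P (a + b)" by (rule band_projection_upper[OF ab])
      finally show "inf a (real n *\<^sub>R y) \<le> P (a + b) - inf b (real m *\<^sub>R y)" by (simp only: le_diff_eq)
    qed
    then show "inf b (real m *\<^sub>R y) \<le> P (a + b) - P a" by (simp only: le_diff_eq add.commute)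
  qed
  then show "P a + P b \<le> P (a + b)" by (simp only: le_diff_eq add.commute)
qed

lemma band_projection_scaleR:
  assumes c: "0 \<le> c" and x: "0 \<le> x"
  shows "P (c *\<^sub>R x) = c *\<^sub>R P x"
proof -
  have le: "P (c *\<^sub>R x) \<le> c *\<^sub>R P x" if c: "0 < c" and x: "0 \<le> x" for c x
  proof (rule band_projection_least)
    show "0 \<le> c *\<^sub>R x" using that by (intro scaleR_nonneg_nonneg) auto
    fix n
    obtain m where m: "real n / c \<le> real m" using real_arch_simple by blast
    have "inf (c *\<^sub>R x) (real n *\<^sub>R y) = c *\<^sub>R inf x ((real n / c) *\<^sub>R y)"
      using c by (simp add: scaleR_inf_lattice)
    also have "\<dots> \<le> c *\<^sub>R inf x (real m *\<^sub>R y)"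
      using c m y by (intro scaleR_left_mono inf_mono scaleR_right_mono) auto
    also have "\<dots> \<le> c *\<^sub>R P x" using c x by (intro scaleR_left_mono band_projection_upper) auto
    finally show "inf (c *\<^sub>R x) (real n *\<^sub>R y) \<le> c *\<^sub>R P x" .
  qed
  show ?thesis
  proof (cases "c = 0")
    case True
    then show ?thesis using band_projection_id[of 0] y by simp
  next
    case False
    then have c: "0 < c" using c by simp
    have "P (inverse c *\<^sub>R c *\<^sub>R x) \<le> inverse c *\<^sub>R P (c *\<^sub>R x)"
      using c x by (intro le scaleR_nonneg_nonneg) auto
    then have "P x \<le> inverse c *\<^sub>R P (c *\<^sub>R x)" using c by simp
    then have "c *\<^sub>R P x \<le> c *\<^sub>R inverse c *\<^sub>R P (c *\<^sub>R x)" using c by (intro scaleR_left_mono) auto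
    then have "c *\<^sub>R P x \<le> P (c *\<^sub>R x)" using c by simp
    with le[OF c x] show ?thesis by (rule antisym)
  qed
qed

lemma band_projection_zero:
  assumes "0 \<le> b" "inf b y = 0"
  shows "P b = 0"
  using assms disjoint_scaleR[OF assms(2)]
  by (intro antisym band_projection_least band_projection_nonneg) auto

lemma band_projection_disjoint:
  assumes "0 \<le> b" "inf b y = 0" "0 \<le> x"
  shows "inf b (P x) = 0"
proof (rule disjoint_Sup[of "range (\<lambda>n. inf x (real n *\<^sub>R y))"])
  show "inf b v = 0" if vin: "v \<in> range (\<lambda>n. inf x (real n *\<^sub>R y))" for v
  proof -
    obtain n where v: "v = inf x (real n *\<^sub>R y)" using vin by blast
    have "0 \<le> v" unfolding v using assms(3) y by (auto intro: scaleR_nonneg_nonneg)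
    then show ?thesis using disjoint_antimono[OF disjoint_scaleR[OF assms(2), of "real n"] assms(1) order_refl, of v]
      by (simp add: v)
  qed
  show "v \<le> P x" if "v \<in> range (\<lambda>n. inf x (real n *\<^sub>R y))" for v
    using that band_projection_upper[OF assms(3)] by blast
  show "P x \<le> u" if "\<And>v. v \<in> range (\<lambda>n. inf x (real n *\<^sub>R y)) \<Longrightarrow> v \<le> u" for u
    using that by (intro band_projection_least[OF assms(3)]) blast
qed (use assms band_projection_nonneg in auto)

text \<open>If \<open>w = inf (x - P x) y\<close>, then \<open>inf x (n y) + w \<le> inf x ((n + 1) y)\<close>, so \<open>P x - w\<close> still bounds the
  sequence whose supremum is \<open>P x\<close>.\<close>
lemma band_projection_complement:
  assumes x: "0 \<le> x"
  shows "inf (x - P x) y = 0"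
proof -
  define w where "w = inf (x - P x) y"
  have w: "0 \<le> w" using band_projection_le[OF x] y by (simp add: w_def)
  have "P x \<le> P x - w"
  proof (rule band_projection_least[OF x])
    fix n
    have "inf x (real n *\<^sub>R y) + w \<le> P x + (x - P x)"
      using band_projection_upper[OF x] by (intro add_mono) (auto simp: w_def)
    then have "inf x (real n *\<^sub>R y) + w \<le> x" by simp
    moreover have "inf x (real n *\<^sub>R y) + w \<le> real n *\<^sub>R y + y"
      by (intro add_mono) (auto simp: w_def)
    then have "inf x (real n *\<^sub>R y) + w \<le> real (Suc n) *\<^sub>R y" by (simp add: scaleR_left_distrib add.commute)
    ultimately have "inf x (real n *\<^sub>R y) + w \<le> inf x (real (Suc n) *\<^sub>R y)" by (rule le_infI)
    also have "\<dots> \<le> P x" by (rule band_projection_upper[OF x])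
    finally show "inf x (real n *\<^sub>R y) \<le> P x - w" by (simp only: le_diff_eq)
  qed
  then have "w \<le> 0" by (simp only: le_diff_eq add_le_same_cancel1)
  with w show ?thesis unfolding w_def by (rule antisym[rotated])
qed

lemma band_projection_functional:
  fixes g :: "'a \<Rightarrow>\<^sub>L real"
  shows "\<exists>h. \<forall>x\<ge>0. blinfun_apply h x = blinfun_apply g (P x)"
proof (rule cone_additive_extension[of "\<lambda>x. blinfun_apply g (P x)" "norm g"])
  fix x :: 'a assume x: "0 \<le> x"
  have "norm (P x) \<le> norm x" using band_projection_nonneg[OF x] band_projection_le[OF x] by (rule norm_mono_pos)
  then show "\<bar>blinfun_apply g (P x)\<bar> \<le> norm g * norm x"
    using norm_blinfun[of g "P x"] mult_left_mono[of "norm (P x)" "norm x" "norm g"] by simp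
qed (auto simp: band_projection_add band_projection_scaleR blinfun.add_right blinfun.scaleR_right)

end

section \<open>From almost limited to limited\<close>

lemma dual_modulus_vanishes:
  fixes f :: "'a::banach_lattice \<Rightarrow>\<^sub>L real"
  assumes u: "is_dual_abs f u" and w: "0 \<le> w" and van: "\<And>v. 0 \<le> v \<Longrightarrow> v \<le> w \<Longrightarrow> blinfun_apply f v = 0"
  shows "blinfun_apply u w \<le> 0"
proof (rule field_le_epsilon)
  fix e :: real assume "0 < e"
  from dual_modulus_formula(1)[OF u w this] obtain y
    where y: "\<bar>y\<bar> \<le> w" "blinfun_apply u w - e < blinfun_apply f y" by blast
  have "blinfun_apply f y = blinfun_apply f (pprt y) - blinfun_apply f (pprt (- y))"
    by (simp add: diff_pprt flip: blinfun.diff_right)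
  also have "\<dots> = 0" using van[of "pprt y"] van[of "pprt (- y)"] y(1) pprt_le_abs[of y] by auto
  finally show "blinfun_apply u w \<le> 0 + e" using y(2) by simp
qed

text \<open>The infimum of two moduli vanishes as soon as every positive \<open>x\<close> splits into two positive parts such
  that each functional is zero on the interval below one of them.\<close>
lemma dual_disjointI:
  fixes f g :: "'a::banach_lattice \<Rightarrow>\<^sub>L real"
  assumes split: "\<And>x. 0 \<le> x \<Longrightarrow> \<exists>w. 0 \<le> w \<and> w \<le> x \<and>
      (\<forall>v. 0 \<le> v \<and> v \<le> x - w \<longrightarrow> blinfun_apply f v = 0) \<and>
      (\<forall>v. 0 \<le> v \<and> v \<le> w \<longrightarrow> blinfun_apply g v = 0)"
  shows "\<exists>u v. is_dual_abs f u \<and> is_dual_abs g v \<and> is_dual_inf u v 0"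
proof -
  obtain u where u: "is_dual_abs f u" by (rule dual_modulus_exists)
  obtain v where v: "is_dual_abs g v" by (rule dual_modulus_exists)
  have "is_dual_inf u v 0"
    unfolding is_dual_inf_def
  proof (intro conjI allI impI)
    show "dual_le 0 u" "dual_le 0 v" using u v by (auto intro: dual_modulus_pos)
    fix k assume k: "dual_le k u \<and> dual_le k v"
    show "dual_le k 0"
      unfolding dual_le_def
    proof (intro allI impI)
      fix x :: 'a assume "0 \<le> x"
      from split[OF this] obtain w where w: "0 \<le> w" "w \<le> x"
        "\<forall>v. 0 \<le> v \<and> v \<le> x - w \<longrightarrow> blinfun_apply f v = 0"
        "\<forall>v. 0 \<le> v \<and> v \<le> w \<longrightarrow> blinfun_apply g v = 0" by (elim exE conjE)
      have "blinfun_apply k x = blinfun_apply k (x - w) + blinfun_apply k w"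
        by (simp flip: blinfun.add_right)
      also have "\<dots> \<le> blinfun_apply u (x - w) + blinfun_apply v w"
        using k w(1,2) by (intro add_mono) (auto simp: dual_le_def)
      also have "\<dots> \<le> 0"
      proof -
        have "blinfun_apply u (x - w) \<le> 0"
          using u by (rule dual_modulus_vanishes) (use w(2,3) in simp_all)
        moreover have "blinfun_apply v w \<le> 0"
          using v w(1) by (rule dual_modulus_vanishes) (use w(4) in simp_all)
        ultimately show ?thesis by simp
      qed
      finally show "blinfun_apply k x \<le> blinfun_apply 0 x" by simp
    qed
  qed
  with u v show ?thesis by blast
qed

lemma weakly_p_summable_subseq:
  assumes "weakly_p_summable p x" "inj s"
  shows "weakly_p_summable p (\<lambda>j. x (s j))"
  unfolding weakly_p_summable_def
proof
  fix f :: "'a \<Rightarrow>\<^sub>L real"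
  have "summable ((\<lambda>n. \<bar>blinfun_apply f (x n)\<bar> powr p) \<circ> s)"
    using assms by (intro summable_reindex) (auto simp: weakly_p_summable_def)
  then show "summable (\<lambda>j. \<bar>blinfun_apply f (x (s j))\<bar> powr p)" by (simp add: o_def)
qed

text \<open>If \<open>f n\<close> does not tend to 0 uniformly on the range of \<open>x\<close>, then \<open>\<bar>f (r j) (x (s j))\<bar> \<ge> e\<close> along two
  subsequences. Composing \<open>f (r j)\<close> with the projection onto the band of \<open>x (s j)\<close> makes the functionals
  disjoint without changing these values.\<close>
lemma disjoint_DP_star_if_sequential:
  assumes sdc: "sigma_dedekind_complete TYPE('a::banach_lattice)"
    and seq: "\<And>(x :: nat \<Rightarrow> 'a) f. weakly_p_summable p x \<Longrightarrow> dual_disjoint_seq f \<Longrightarrow> weak_star_null f \<Longrightarrow>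
      (\<lambda>n. blinfun_apply (f n) (x n)) \<longlonglongrightarrow> 0"
  shows "disjoint_DP_star p TYPE('a)"
  unfolding disjoint_DP_star_def limited_def
proof (intro allI impI)
  fix x :: "nat \<Rightarrow> 'a" and f :: "nat \<Rightarrow> 'a \<Rightarrow>\<^sub>L real"
  assume x: "disjoint_seq x \<and> weakly_p_summable p x" and f: "weak_star_null f"
  show "uniform_limit (range x) (\<lambda>n. blinfun_apply (f n)) (\<lambda>_. 0) sequentially"
  proof (rule ccontr)
    assume "\<not> ?thesis"
    then obtain e where e: "0 < e"
      "\<not> eventually (\<lambda>n. \<forall>y\<in>range x. dist (blinfun_apply (f n) y) 0 < e) sequentially"
      unfolding uniform_limit_iff by blast
    have often: "\<exists>n\<ge>N. \<exists>k. e \<le> \<bar>blinfun_apply (f n) (x k)\<bar>" for N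
      using e(2) by (simp add: eventually_sequentially not_less)
    have ev: "eventually (\<lambda>n. \<not> e \<le> \<bar>blinfun_apply (f n) (x k)\<bar>) sequentially" for k
    proof -
      have "(\<lambda>n. \<bar>blinfun_apply (f n) (x k)\<bar>) \<longlonglongrightarrow> 0"
        using f by (auto simp: weak_star_null_def intro: tendsto_rabs_zero)
      from order_tendstoD(2)[OF this e(1)] show ?thesis by (simp add: not_le)
    qed
    obtain r s :: "nat \<Rightarrow> nat" where rs: "strict_mono r" "strict_mono s"
      "\<And>j. e \<le> \<bar>blinfun_apply (f (r j)) (x (s j))\<bar>"
      using strict_mono_selection[OF often ev] by blast
    define y where "y j = x (s j)" for j
    define g where "g j = f (r j)" for j
    have y: "weakly_p_summable p y"
      unfolding y_def
      by (rule weakly_p_summable_subseq[OF conjunct2[OF x] strict_mono_imp_inj_on[OF rs(2)]])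
    have dis: "inf \<bar>y i\<bar> \<bar>y j\<bar> = 0" if "i \<noteq> j" for i j
    proof -
      have "s i \<noteq> s j" using that rs(2) by (simp add: strict_mono_eq)
      with conjunct1[OF x] show ?thesis by (simp add: disjoint_seq_def y_def)
    qed
    have g: "weak_star_null g" unfolding g_def using f rs(1) by (rule weak_star_null_subseq)
    define P where "P j = (SOME P. is_band_projection \<bar>y j\<bar> P)" for j
    have P: "is_band_projection \<bar>y j\<bar> (P j)" for j
      unfolding P_def by (rule someI_ex[OF band_projection_exists[OF sdc]])
    have "\<exists>h. \<forall>v\<ge>0. blinfun_apply h v = blinfun_apply (g j) (P j v)" for j
      by (rule band_projection_functional[OF abs_ge_zero P])
    then obtain h where h: "\<And>j v. 0 \<le> v \<Longrightarrow> blinfun_apply (h j) v = blinfun_apply (g j) (P j v)" by metis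
    have hy: "blinfun_apply (h j) (y j) = blinfun_apply (g j) (y j)" for j
    proof -
      have "P j (pprt (y j)) = pprt (y j)" "P j (pprt (- y j)) = pprt (- y j)"
        using band_projection_id[OF abs_ge_zero P[of j]] pprt_le_abs[of "y j"] by auto
      then have "blinfun_apply (h j) (pprt (y j) - pprt (- y j)) = blinfun_apply (g j) (pprt (y j) - pprt (- y j))"
        by (simp add: blinfun.diff_right h)
      then show ?thesis by (simp add: diff_pprt)
    qed
    have disP: "inf (P i v) \<bar>y j\<bar> = 0" if "i \<noteq> j" "0 \<le> v" for i j v
      using band_projection_disjoint[OF abs_ge_zero P[of i] abs_ge_zero dis[of j i] that(2)] that(1)
      by (simp add: inf_commute)
    have "dual_disjoint_seq h"
      unfolding dual_disjoint_seq_def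
    proof (intro allI impI dual_disjointI)
      fix i j :: nat and v :: 'a assume ij: "i \<noteq> j" and v: "0 \<le> v"
      have zero: "blinfun_apply (h k) t = 0" if "0 \<le> t" "inf a \<bar>y k\<bar> = 0" "t \<le> a" for k and t a :: 'a
        using that disjoint_antimono[OF that(2,1,3) abs_ge_zero order_refl]
        by (simp add: h band_projection_zero[OF abs_ge_zero P])
      show "\<exists>w. 0 \<le> w \<and> w \<le> v \<and> (\<forall>t. 0 \<le> t \<and> t \<le> v - w \<longrightarrow> blinfun_apply (h i) t = 0) \<and>
          (\<forall>t. 0 \<le> t \<and> t \<le> w \<longrightarrow> blinfun_apply (h j) t = 0)"
      proof (intro exI[of _ "P i v"] conjI allI impI)
        show "0 \<le> P i v" "P i v \<le> v"
          using band_projection_nonneg[OF abs_ge_zero P v] band_projection_le[OF abs_ge_zero P v] by auto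
        show "blinfun_apply (h i) t = 0" if "0 \<le> t \<and> t \<le> v - P i v" for t
          by (rule zero[OF _ band_projection_complement[OF abs_ge_zero P v]]) (use that in auto)
        show "blinfun_apply (h j) t = 0" if "0 \<le> t \<and> t \<le> P i v" for t
          by (rule zero[OF _ disP[OF ij v]]) (use that in auto)
      qed
    qed
    moreover have "weak_star_null h"
      unfolding weak_star_null_def
    proof
      fix v
      \<comment> \<open>the projections of a fixed vector are disjoint and order bounded\<close>
      have pos: "(\<lambda>j. blinfun_apply (h j) v) \<longlonglongrightarrow> 0" if v: "0 \<le> v" for v
        unfolding h[OF v]
      proof (rule weak_star_null_disjoint_order_bounded[OF sdc g])
        show "0 \<le> P j v" "P j v \<le> v" for j
          using band_projection_nonneg[OF abs_ge_zero P v] band_projection_le[OF abs_ge_zero P v] by auto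
        show "inf (P i v) (P j v) = 0" if "i \<noteq> j" for i j
          using band_projection_disjoint[OF abs_ge_zero P[of j] _ disP[OF that v] v]
            band_projection_nonneg[OF abs_ge_zero P v] by blast
      qed
      have "(\<lambda>j. blinfun_apply (h j) (pprt v) - blinfun_apply (h j) (pprt (- v))) \<longlonglongrightarrow> 0 - 0"
        by (intro tendsto_diff pos zero_le_pprt)
      then show "(\<lambda>j. blinfun_apply (h j) v) \<longlonglongrightarrow> 0" by (simp add: diff_pprt flip: blinfun.diff_right)
    qed
    ultimately have "(\<lambda>j. blinfun_apply (h j) (y j)) \<longlonglongrightarrow> 0" using y by (intro seq)
    moreover have "e \<le> \<bar>blinfun_apply (h j) (y j)\<bar>" for j
      using rs(3)[of j] unfolding hy unfolding y_def g_def .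
    ultimately have "e \<le> 0" by (intro LIMSEQ_le_const[OF tendsto_rabs_zero]) auto
    with e(1) show False by simp
  qed
qed

section \<open>Weakly p-summable sequences\<close>

text \<open>Uniform boundedness on the dual space. The least such \<open>K\<close> is the \<open>p\<close>-th power of the weak
  $\ell_p$-norm of the sequence.\<close>
lemma weakly_p_summable_uniform:
  fixes x :: "nat \<Rightarrow> 'a::banach"
  assumes p: "1 \<le> p" and x: "weakly_p_summable p x"
  shows "\<exists>K. \<forall>g N. norm g \<le> 1 \<longrightarrow> (\<Sum>n<N. \<bar>blinfun_apply g (x n)\<bar> powr p) \<le> K"
proof -
  define \<Phi> where "\<Phi> N g = (\<Sum>n<N. \<bar>blinfun_apply g (x n)\<bar> powr p)" for N :: nat and g :: "'a \<Rightarrow>\<^sub>L real"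
  have powr_diff_le: "\<bar>a - b\<bar> powr p \<le> 2 powr p * (\<bar>a\<bar> powr p + \<bar>b\<bar> powr p)" for a b :: real
  proof -
    have "\<bar>a - b\<bar> powr p \<le> (2 * max \<bar>a\<bar> \<bar>b\<bar>) powr p" using p by (intro powr_mono2) auto
    also have "\<dots> = 2 powr p * max \<bar>a\<bar> \<bar>b\<bar> powr p" by (rule powr_mult)
    also have "\<dots> \<le> 2 powr p * (\<bar>a\<bar> powr p + \<bar>b\<bar> powr p)"
      by (intro mult_left_mono) (auto simp: max_def)
    finally show ?thesis .
  qed
  have "\<exists>r>0. \<exists>K. \<forall>N g. norm g < r \<longrightarrow> \<Phi> N g \<le> K"
  proof (rule uniform_boundedness)
    show "continuous_on UNIV (\<Phi> N)" for N
      unfolding \<Phi>_def using p by (intro continuous_on_sum continuous_on_powr' continuous_intros) auto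
    show "\<exists>M. \<forall>N. \<Phi> N g \<le> M" for g
    proof -
      have "summable (\<lambda>n. \<bar>blinfun_apply g (x n)\<bar> powr p)" using x by (simp add: weakly_p_summable_def)
      then have "\<Phi> N g \<le> (\<Sum>n. \<bar>blinfun_apply g (x n)\<bar> powr p)" for N
        unfolding \<Phi>_def by (intro sum_le_suminf) auto
      then show ?thesis by blast
    qed
    show "\<Phi> N (g - h) \<le> 2 powr p * (\<Phi> N g + \<Phi> N h)" for N g h
      unfolding \<Phi>_def sum.distrib[symmetric] sum_distrib_left
      by (intro sum_mono) (simp only: blinfun.diff_left powr_diff_le)
  qed simp
  then obtain r K where r: "0 < r" and K: "\<And>N g. norm g < r \<Longrightarrow> \<Phi> N g \<le> K" by blast
  have "\<Phi> N g \<le> K / (r / 2) powr p" if g: "norm g \<le> 1" for N g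
  proof -
    have "r / 2 * norm g \<le> r / 2 * 1" using g r by (intro mult_left_mono) auto
    then have "norm ((r / 2) *\<^sub>R g) < r" using r by simp
    then have "\<Phi> N ((r / 2) *\<^sub>R g) \<le> K" by (rule K)
    moreover have "\<Phi> N ((r / 2) *\<^sub>R g) = (r / 2) powr p * \<Phi> N g"
    proof -
      have "\<bar>blinfun_apply ((r / 2) *\<^sub>R g) (x n)\<bar> powr p = (r / 2) powr p * \<bar>blinfun_apply g (x n)\<bar> powr p" for n
      proof -
        have "\<bar>blinfun_apply ((r / 2) *\<^sub>R g) (x n)\<bar> = r / 2 * \<bar>blinfun_apply g (x n)\<bar>"
          using r by (simp add: blinfun.scaleR_left abs_mult)
        then show ?thesis by (simp only: powr_mult)
      qed
      then show ?thesis by (simp only: \<Phi>_def sum_distrib_left)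
    qed
    ultimately show ?thesis using r by (simp add: field_simps)
  qed
  then show ?thesis unfolding \<Phi>_def by blast
qed

lemma weakly_p_summable_bounded:
  fixes x :: "nat \<Rightarrow> 'a::banach"
  assumes p: "1 \<le> p" and x: "weakly_p_summable p x"
  shows "\<exists>B. \<forall>n. norm (x n) \<le> B"
proof -
  obtain K where K: "\<And>g N. norm g \<le> 1 \<Longrightarrow> (\<Sum>n<N. \<bar>blinfun_apply g (x n)\<bar> powr p) \<le> K"
    using weakly_p_summable_uniform[OF assms] by blast
  have "norm (x n) \<le> max 1 K" for n
  proof (cases "norm (x n) \<le> 1")
    case False
    obtain g where g: "norm g \<le> 1" "blinfun_apply g (x n) = norm (x n)" by (rule norming_functional)
    have "norm (x n) powr 1 \<le> norm (x n) powr p" using False p by (intro powr_mono) auto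
    then have "norm (x n) \<le> \<bar>blinfun_apply g (x n)\<bar> powr p" using False g(2) by simp
    also have "\<dots> \<le> (\<Sum>k<Suc n. \<bar>blinfun_apply g (x k)\<bar> powr p)"
      by (rule member_le_sum) auto
    also have "\<dots> \<le> K" by (rule K[OF g(1)])
    finally show ?thesis by simp
  qed simp
  then show ?thesis by blast
qed

text \<open>The majorant is the average of the \<open>\<bar>w \<plusminus> y 0 \<plusminus> y 1 \<plusminus> ...\<bar>\<close> over all signs. The induction rests on
  \<open>sup \<bar>a\<bar> \<bar>b\<bar> \<le> (\<bar>a + b\<bar> + \<bar>a - b\<bar>) / 2\<close>, and the norm bound survives because each signed sum satisfies it.\<close>
lemma common_majorant_of_signed_sums:
  fixes y :: "nat \<Rightarrow> 'a::banach_lattice"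
  assumes "\<And>s. (\<forall>i. s i = 1 \<or> s i = (- 1 :: real)) \<Longrightarrow> norm (w + (\<Sum>i<n. s i *\<^sub>R y i)) \<le> B"
  shows "\<exists>u. \<bar>w\<bar> \<le> u \<and> (\<forall>i<n. \<bar>y i\<bar> \<le> u) \<and> norm u \<le> B"
  using assms
proof (induction n arbitrary: w)
  case 0
  then show ?case using 0[of "\<lambda>_. 1"] by (intro exI[of _ "\<bar>w\<bar>"]) auto
next
  case (Suc n)
  have step: "\<exists>u. \<bar>w + e *\<^sub>R y n\<bar> \<le> u \<and> (\<forall>i<n. \<bar>y i\<bar> \<le> u) \<and> norm u \<le> B" if e: "e = 1 \<or> e = - 1" for e :: real
  proof (rule Suc.IH)
    fix s :: "nat \<Rightarrow> real" assume s: "\<forall>i. s i = 1 \<or> s i = - 1"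
    have "norm (w + (\<Sum>i<Suc n. (s(n := e)) i *\<^sub>R y i)) \<le> B"
      by (rule Suc.prems) (use s e in auto)
    moreover have "(\<Sum>i<n. (s(n := e)) i *\<^sub>R y i) = (\<Sum>i<n. s i *\<^sub>R y i)" by (intro sum.cong) auto
    ultimately show "norm (w + e *\<^sub>R y n + (\<Sum>i<n. s i *\<^sub>R y i)) \<le> B"
      by (simp add: add.assoc add.commute)
  qed
  obtain u1 where u1: "\<bar>w + y n\<bar> \<le> u1" "\<And>i. i < n \<Longrightarrow> \<bar>y i\<bar> \<le> u1" "norm u1 \<le> B"
    using step[of 1] by auto
  obtain u2 where u2: "\<bar>w - y n\<bar> \<le> u2" "\<And>i. i < n \<Longrightarrow> \<bar>y i\<bar> \<le> u2" "norm u2 \<le> B"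
    using step[of "- 1"] by auto
  define u where "u = (1/2) *\<^sub>R (u1 + u2)"
  have half: "\<bar>a\<bar> \<le> u" if "a = (1/2) *\<^sub>R (b + c)" "\<bar>b\<bar> \<le> u1" "\<bar>c\<bar> \<le> u2" for a b c
  proof -
    have "\<bar>a\<bar> = (1/2) *\<^sub>R \<bar>b + c\<bar>" unfolding that(1) by (rule abs_scaleR_lattice) simp
    also have "\<dots> \<le> (1/2) *\<^sub>R (u1 + u2)"
      using abs_triangle_ineq[of b c] add_mono[OF that(2,3)] by (intro scaleR_left_mono) auto
    finally show ?thesis by (simp add: u_def)
  qed
  have double: "a = (1/2) *\<^sub>R (a + a)" for a :: 'a by (simp flip: scaleR_2)
  show ?case
  proof (intro exI[of _ u] conjI allI impI)
    show "\<bar>w\<bar> \<le> u" by (rule half[OF _ u1(1) u2(1)]) (simp add: double[symmetric])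
    have y: "\<bar>y n\<bar> \<le> u"
    proof (rule half[OF _ u1(1)])
      show "\<bar>y n - w\<bar> \<le> u2" using u2(1) by (simp add: abs_minus_commute)
    qed (simp add: double[symmetric])
    show "\<bar>y i\<bar> \<le> u" if "i < Suc n" for i
    proof (cases "i = n")
      case False
      with that show ?thesis using half[OF double u1(2) u2(2), of i] by simp
    qed (simp add: y)
    show "norm u \<le> B"
      using norm_triangle_ineq[of u1 u2] u1(3) u2(3) by (simp add: u_def)
  qed
qed

text \<open>A substitute for Hoelder's inequality that treats \<open>p = 1\<close> uniformly; one of the two summands on the
  right already dominates, according to whether \<open>b \<le> \<delta> t\<close>.\<close>
lemma powr_young:
  fixes t b \<delta> p :: real
  assumes "0 \<le> t" "0 \<le> b" "0 < \<delta>" "1 \<le> p"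
  shows "t powr (p - 1) * b \<le> \<delta> * t powr p + \<delta> powr (1 - p) * b powr p"
proof -
  have pw: "s powr p = s powr (p - 1) * s" if "0 \<le> s" for s :: real
    using powr_add[of s "p - 1" 1] that by simp
  show ?thesis
  proof (cases "b \<le> \<delta> * t")
    case True
    have "t powr (p - 1) * b \<le> t powr (p - 1) * (\<delta> * t)" using True by (intro mult_left_mono) auto
    also have "\<dots> = \<delta> * t powr p" using pw[OF assms(1)] by simp
    finally show ?thesis by (simp add: add_increasing2)
  next
    case False
    then have "t \<le> b / \<delta>" using assms(3) by (simp add: field_simps)
    then have "t powr (p - 1) * b \<le> (b / \<delta>) powr (p - 1) * b"
      using assms by (intro mult_right_mono powr_mono2) auto
    also have "\<dots> = \<delta> powr (1 - p) * b powr p"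
      using pw[OF assms(2)] assms by (simp add: powr_divide powr_diff field_simps)
    finally show ?thesis using assms by (simp add: add_increasing)
  qed
qed

text \<open>Let \<open>\<phi>\<close> be the modulus of \<open>f\<close> and \<open>t n = \<phi> (z n)\<close>. With the weights \<open>a n = t n powr (p - 1)\<close> the sum \<open>S\<close> of
  the \<open>t n powr p\<close> is \<open>\<phi>\<close> at \<open>\<Sum> a n z n\<close>. This is a sum of disjoint vectors, so it lies below any common
  majorant of the \<open>\<bar>a n x n\<bar>\<close>, in particular below one of norm at most \<open>\<delta> S + C\<close>, where \<open>C\<close> does not
  depend on the number of terms. For small \<open>\<delta>\<close> the term \<open>\<delta> S\<close> is absorbed and \<open>S\<close> is bounded.\<close>
lemma weakly_p_summable_disjoint_minorant:
  fixes x z :: "nat \<Rightarrow> 'a::banach_lattice"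
  assumes p: "1 \<le> p" and x: "weakly_p_summable p x"
    and pos: "\<And>n. 0 \<le> z n" and le: "\<And>n. z n \<le> \<bar>x n\<bar>" and dis: "\<And>m n. m \<noteq> n \<Longrightarrow> inf (z m) (z n) = 0"
  shows "weakly_p_summable p z"
  unfolding weakly_p_summable_def
proof
  fix f :: "'a \<Rightarrow>\<^sub>L real"
  obtain \<phi> where \<phi>: "is_dual_abs f \<phi>" by (rule dual_modulus_exists)
  obtain K where K: "\<And>g N. norm g \<le> 1 \<Longrightarrow> (\<Sum>n<N. \<bar>blinfun_apply g (x n)\<bar> powr p) \<le> K"
    using weakly_p_summable_uniform[OF p x] by blast
  define t where "t n = blinfun_apply \<phi> (z n)" for n
  define a where "a n = t n powr (p - 1)" for n
  have t: "0 \<le> t n" "\<bar>blinfun_apply f (z n)\<bar> \<le> t n" for n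
    using positive_functional_nonneg[OF dual_modulus_pos[OF \<phi>] pos] dual_modulus_ge[OF \<phi>, of "z n" "z n"] pos
    by (simp_all add: t_def)
  have a: "0 \<le> a n" for n by (simp add: a_def)
  define \<delta> where "\<delta> = 1 / (2 * (norm f + 1))"
  have \<delta>: "0 < \<delta>" "norm f * \<delta> \<le> 1 / 2"
  proof -
    have "0 < norm f + 1" by (simp add: add_nonneg_pos)
    then show "0 < \<delta>" "norm f * \<delta> \<le> 1 / 2" by (simp_all add: \<delta>_def field_simps)
  qed
  define C where "C = \<delta> powr (1 - p) * K"
  have bound: "(\<Sum>n<N. t n powr p) \<le> 2 * (norm f * C)" for N
  proof -
    define S where "S = (\<Sum>n<N. t n powr p)"
    have "\<exists>u. \<bar>0::'a\<bar> \<le> u \<and> (\<forall>i<N. \<bar>a i *\<^sub>R x i\<bar> \<le> u) \<and> norm u \<le> \<delta> * S + C"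
    proof (rule common_majorant_of_signed_sums)
      fix s :: "nat \<Rightarrow> real" assume s: "\<forall>i. s i = 1 \<or> s i = - 1"
      define v where "v = (\<Sum>i<N. s i *\<^sub>R a i *\<^sub>R x i)"
      obtain g where g: "norm g \<le> 1" "blinfun_apply g v = norm v" by (rule norming_functional)
      have "norm v = (\<Sum>i<N. s i * (a i * blinfun_apply g (x i)))"
        unfolding g(2)[symmetric] by (simp add: v_def blinfun.sum_right blinfun.scaleR_right mult.assoc)
      also have "\<dots> \<le> (\<Sum>i<N. \<delta> * t i powr p + \<delta> powr (1 - p) * \<bar>blinfun_apply g (x i)\<bar> powr p)"
      proof (rule sum_mono)
        fix i
        have "\<bar>s i\<bar> = 1" using s[rule_format, of i] by auto
        have "s i * (a i * blinfun_apply g (x i)) \<le> \<bar>s i * (a i * blinfun_apply g (x i))\<bar>" by simp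
        also have "\<dots> = t i powr (p - 1) * \<bar>blinfun_apply g (x i)\<bar>"
          using \<open>\<bar>s i\<bar> = 1\<close> by (simp add: abs_mult a_def)
        also have "\<dots> \<le> \<delta> * t i powr p + \<delta> powr (1 - p) * \<bar>blinfun_apply g (x i)\<bar> powr p"
          using t(1) \<delta>(1) p by (intro powr_young) auto
        finally show "s i * (a i * blinfun_apply g (x i)) \<le>
            \<delta> * t i powr p + \<delta> powr (1 - p) * \<bar>blinfun_apply g (x i)\<bar> powr p" .
      qed
      also have "\<dots> = \<delta> * S + \<delta> powr (1 - p) * (\<Sum>i<N. \<bar>blinfun_apply g (x i)\<bar> powr p)"
        by (simp add: sum.distrib sum_distrib_left S_def)
      also have "\<dots> \<le> \<delta> * S + C"
        unfolding C_def using K[OF g(1)] by (intro add_left_mono mult_left_mono) auto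
      finally show "norm (0 + (\<Sum>i<N. s i *\<^sub>R a i *\<^sub>R x i)) \<le> \<delta> * S + C" by (simp add: v_def)
    qed
    then obtain u where u: "0 \<le> u" "\<And>i. i < N \<Longrightarrow> \<bar>a i *\<^sub>R x i\<bar> \<le> u" "norm u \<le> \<delta> * S + C"
      by auto
    have "(\<Sum>i<N. a i *\<^sub>R z i) \<le> u"
    proof (rule disjoint_sum_le[OF u(1)])
      show "0 \<le> a i *\<^sub>R z i" for i using a pos by (rule scaleR_nonneg_nonneg)
      show "a i *\<^sub>R z i \<le> u" if "i < N" for i
      proof -
        have "a i *\<^sub>R z i \<le> a i *\<^sub>R \<bar>x i\<bar>" using le a by (rule scaleR_left_mono)
        also have "\<dots> = \<bar>a i *\<^sub>R x i\<bar>" using a by (simp add: abs_scaleR_lattice)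
        also have "\<dots> \<le> u" using that by (rule u(2))
        finally show ?thesis .
      qed
      show "inf (a i *\<^sub>R z i) (a j *\<^sub>R z j) = 0" if "i \<noteq> j" for i j
      proof -
        have "inf (z i) (a j *\<^sub>R z j) = 0" using dis[OF that] a by (rule disjoint_scaleR)
        then have "inf (a j *\<^sub>R z j) (z i) = 0" by (simp only: inf_commute)
        then have "inf (a j *\<^sub>R z j) (a i *\<^sub>R z i) = 0" using a by (rule disjoint_scaleR)
        then show ?thesis by (simp only: inf_commute)
      qed
    qed
    have "S = (\<Sum>n<N. a n * t n)"
      unfolding S_def a_def
    proof (rule sum.cong)
      show "t n powr p = t n powr (p - 1) * t n" for n using powr_add[of "t n" "p - 1" 1] t(1)[of n] by simp
    qed simp
    also have "\<dots> = blinfun_apply \<phi> (\<Sum>i<N. a i *\<^sub>R z i)"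
      by (simp add: blinfun.sum_right blinfun.scaleR_right t_def)
    also have "\<dots> \<le> blinfun_apply \<phi> u"
      using dual_modulus_pos[OF \<phi>] \<open>(\<Sum>i<N. a i *\<^sub>R z i) \<le> u\<close> by (rule positive_functional_mono)
    also have "\<dots> \<le> norm f * norm u" using \<phi> u(1) by (rule dual_modulus_le_norm)
    also have "\<dots> \<le> norm f * (\<delta> * S + C)" using u(3) by (intro mult_left_mono) auto
    also have "\<dots> = (norm f * \<delta>) * S + norm f * C" by (simp add: algebra_simps)
    also have "\<dots> \<le> (1 / 2) * S + norm f * C"
      using \<delta>(2) by (intro add_right_mono mult_right_mono) (auto simp: S_def intro: sum_nonneg)
    finally have "S \<le> (1 / 2) * S + norm f * C" .
    then show ?thesis unfolding S_def by linarith
  qed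
  have "summable (\<lambda>n. t n powr p)"
    by (rule summableI_nonneg_bounded[OF _ bound]) simp
  then show "summable (\<lambda>n. \<bar>blinfun_apply f (z n)\<bar> powr p)"
    by (rule summable_comparison_test'[where N = 0]) (use t p in \<open>auto intro!: powr_mono2\<close>)
qed

section \<open>The sequential form of the p-weak DP* property\<close>

lemma weakly_p_summable_zero: "weakly_p_summable p (\<lambda>_. 0)"
  by (simp add: weakly_p_summable_def blinfun.zero_right)

text \<open>A sequence in the set either takes some value infinitely often, and then has a constant subsequence,
  or runs through \<open>x\<close> with indices tending to infinity.\<close>
lemma weakly_p_compact_range:
  fixes x :: "nat \<Rightarrow> 'a::banach"
  assumes x: "weakly_p_summable p x"
  shows "weakly_p_compact p (insert 0 (range x))"
  unfolding weakly_p_compact_def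
proof (intro allI impI)
  fix s :: "nat \<Rightarrow> 'a" assume s: "range s \<subseteq> insert 0 (range x)"
  show "\<exists>r a. strict_mono r \<and> a \<in> insert 0 (range x) \<and> weakly_p_summable p (\<lambda>j. s (r j) - a)"
  proof (cases "\<exists>a. infinite {n. s n = a}")
    case True
    then obtain a where "infinite {n. s n = a}" by blast
    then obtain r :: "nat \<Rightarrow> nat" where r: "strict_mono r" "\<And>n. r n \<in> {n. s n = a}"
      using infinite_enumerate by blast
    then have "s (r j) = a" for j by simp
    moreover from this[of 0] s have "a \<in> insert 0 (range x)" by blast
    ultimately show ?thesis using r(1) weakly_p_summable_zero[of p]
      by (intro exI[of _ r] exI[of _ a]) simp
  next
    case False
    then have fin: "finite {n. s n = a}" for a by blast
    have ev: "eventually (\<lambda>n. s n \<noteq> a) sequentially" for a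
      using fin[of a] by (simp add: eventually_cofinite flip: cofinite_eq_sequentially)
    have often: "\<exists>n\<ge>N. \<exists>k. s n = x k" for N
    proof -
      obtain M where M: "\<And>n. M \<le> n \<Longrightarrow> s n \<noteq> 0" using ev[of 0] by (auto simp: eventually_sequentially)
      have "s (max M N) \<in> insert 0 (range x)" using s by blast
      with M[of "max M N"] show ?thesis by (intro exI[of _ "max M N"]) auto
    qed
    obtain r t :: "nat \<Rightarrow> nat" where rt: "strict_mono r" "strict_mono t" "\<And>j. s (r j) = x (t j)"
      using strict_mono_selection[of "\<lambda>n k. s n = x k", OF often ev] by blast
    have "weakly_p_summable p (\<lambda>j. s (r j) - 0)"
      using weakly_p_summable_subseq[OF x strict_mono_imp_inj_on[OF rt(2)]] rt(3) by simp
    with rt(1) show ?thesis by blast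
  qed
qed

lemma weakly_p_compact_bounded:
  fixes A :: "'a::banach set"
  assumes p: "1 \<le> p" and A: "weakly_p_compact p A"
  shows "bounded A"
proof (rule ccontr)
  assume "\<not> bounded A"
  then have "\<exists>a\<in>A. real n < norm a" for n by (force simp: bounded_iff not_le)
  then obtain x where x: "\<And>n. x n \<in> A" "\<And>n. real n < norm (x n)" by metis
  then have "range x \<subseteq> A" by blast
  then obtain r a where ra: "strict_mono r" "weakly_p_summable p (\<lambda>j. x (r j) - a)"
    using A unfolding weakly_p_compact_def by blast
  obtain B where B: "\<And>j. norm (x (r j) - a) \<le> B" using weakly_p_summable_bounded[OF p ra(2)] by blast
  obtain j where j: "B + norm a < real j" using reals_Archimedean2 by blast
  have "real j \<le> real (r j)" using seq_suble[OF ra(1)] by simp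
  also have "\<dots> < norm (x (r j))" by (rule x(2))
  also have "\<dots> \<le> norm (x (r j) - a) + norm a" using norm_triangle_ineq[of "x (r j) - a" a] by simp
  also have "\<dots> \<le> B + norm a" using B by simp
  finally show False using j by simp
qed

text \<open>From right to left, a failure of uniform convergence on \<open>A\<close> is witnessed by points \<open>y n \<in> A\<close>. A
  subsequence of them is weakly \<open>p\<close>-summable after subtracting a fixed \<open>a\<close>, and \<open>f n a \<longlonglongrightarrow> 0\<close>
  anyway.\<close>
lemma p_weak_DP_star_iff_sequential:
  assumes p: "1 \<le> p"
  shows "p_weak_DP_star p TYPE('a::banach_lattice) \<longleftrightarrow>
    (\<forall>(x :: nat \<Rightarrow> 'a) f. weakly_p_summable p x \<longrightarrow> dual_disjoint_seq f \<longrightarrow> weak_star_null f \<longrightarrow>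
      (\<lambda>n. blinfun_apply (f n) (x n)) \<longlonglongrightarrow> 0)"
proof (intro iffI allI impI)
  fix x :: "nat \<Rightarrow> 'a" and f :: "nat \<Rightarrow> 'a \<Rightarrow>\<^sub>L real"
  assume pw: "p_weak_DP_star p TYPE('a)" and x: "weakly_p_summable p x"
    and f: "dual_disjoint_seq f" "weak_star_null f"
  have "almost_limited (insert 0 (range x))"
    using pw weakly_p_compact_range[OF x] by (simp add: p_weak_DP_star_def)
  with f have lim: "uniform_limit (insert 0 (range x)) (\<lambda>n. blinfun_apply (f n)) (\<lambda>_. 0) sequentially"
    by (simp add: almost_limited_def)
  show "(\<lambda>n. blinfun_apply (f n) (x n)) \<longlonglongrightarrow> 0"
  proof (rule tendstoI)
    fix e :: real assume "0 < e"
    from uniform_limitD[OF lim this]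
    show "eventually (\<lambda>n. dist (blinfun_apply (f n) (x n)) 0 < e) sequentially"
      by eventually_elim simp
  qed
next
  assume seq: "\<forall>(x :: nat \<Rightarrow> 'a) f. weakly_p_summable p x \<longrightarrow> dual_disjoint_seq f \<longrightarrow> weak_star_null f \<longrightarrow>
      (\<lambda>n. blinfun_apply (f n) (x n)) \<longlonglongrightarrow> 0"
  show "p_weak_DP_star p TYPE('a)"
    unfolding p_weak_DP_star_def almost_limited_def
  proof (intro allI impI conjI)
    fix A :: "'a set" assume A: "weakly_p_compact p A"
    show "bounded A" using p A by (rule weakly_p_compact_bounded)
    fix f :: "nat \<Rightarrow> 'a \<Rightarrow>\<^sub>L real" assume f: "dual_disjoint_seq f \<and> weak_star_null f"
    show "uniform_limit A (\<lambda>n. blinfun_apply (f n)) (\<lambda>_. 0) sequentially"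
    proof (rule ccontr)
      assume "\<not> ?thesis"
      then obtain e where e: "0 < e"
        "\<not> eventually (\<lambda>n. \<forall>y\<in>A. dist (blinfun_apply (f n) y) 0 < e) sequentially"
        unfolding uniform_limit_iff by blast
      then have "infinite {n. \<exists>y\<in>A. e \<le> \<bar>blinfun_apply (f n) y\<bar>}"
        by (simp add: infinite_nat_iff_unbounded_le eventually_sequentially not_less)
      then obtain r :: "nat \<Rightarrow> nat" where r: "strict_mono r"
        "\<And>n. r n \<in> {n. \<exists>y\<in>A. e \<le> \<bar>blinfun_apply (f n) y\<bar>}"
        using infinite_enumerate by blast
      then have "\<forall>n. \<exists>y. y \<in> A \<and> e \<le> \<bar>blinfun_apply (f (r n)) y\<bar>" by blast
      then obtain y where y: "\<And>n. y n \<in> A" "\<And>n. e \<le> \<bar>blinfun_apply (f (r n)) (y n)\<bar>"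
        by metis
      then have "range y \<subseteq> A" by blast
      then obtain t a where ta: "strict_mono t" "weakly_p_summable p (\<lambda>j. y (t j) - a)"
        using A unfolding weakly_p_compact_def by blast
      define s where "s j = r (t j)" for j
      have s: "strict_mono s" using r(1) ta(1) by (simp add: s_def strict_mono_def)
      have g: "weak_star_null (\<lambda>j. f (s j))" using conjunct2[OF f] s by (rule weak_star_null_subseq)
      have "dual_disjoint_seq (\<lambda>j. f (s j))"
        unfolding dual_disjoint_seq_def
      proof (intro allI impI)
        fix m n :: nat assume "m \<noteq> n"
        then have "s m \<noteq> s n" using s by (simp add: strict_mono_eq)
        with conjunct1[OF f] show "\<exists>u v. is_dual_abs (f (s m)) u \<and> is_dual_abs (f (s n)) v \<and> is_dual_inf u v 0"
          unfolding dual_disjoint_seq_def by simp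
      qed
      then have "(\<lambda>j. blinfun_apply (f (s j)) (y (t j) - a)) \<longlonglongrightarrow> 0"
        using seq ta(2) g by simp
      moreover have "(\<lambda>j. blinfun_apply (f (s j)) a) \<longlonglongrightarrow> 0" using g by (simp add: weak_star_null_def)
      ultimately have "(\<lambda>j. blinfun_apply (f (s j)) (y (t j) - a) + blinfun_apply (f (s j)) a) \<longlonglongrightarrow> 0 + 0"
        by (rule tendsto_add)
      then have lim: "(\<lambda>j. blinfun_apply (f (s j)) (y (t j))) \<longlonglongrightarrow> 0"
        by (simp flip: blinfun.add_right)
      have "e \<le> \<bar>blinfun_apply (f (s j)) (y (t j))\<bar>" for j
        unfolding s_def by (rule y(2))
      then have "e \<le> 0" by (intro LIMSEQ_le_const[OF tendsto_rabs_zero[OF lim]]) auto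
      with e(1) show False by simp
    qed
  qed
qed

section \<open>Disjoint weak* null sequences have weak* null moduli\<close>

text \<open>For positive functionals on a Banach lattice the splitting condition is equivalent to pairwise
  disjointness; it is the form in which disjointness is used.\<close>
definition separated_on_cone :: "('i \<Rightarrow> ('a::banach_lattice \<Rightarrow>\<^sub>L real)) \<Rightarrow> bool" where
  "separated_on_cone \<phi> \<longleftrightarrow> (\<forall>i. positive_functional (\<phi> i)) \<and>
     (\<forall>i j x e. i \<noteq> j \<longrightarrow> 0 \<le> x \<longrightarrow> 0 < e \<longrightarrow>
        (\<exists>w. 0 \<le> w \<and> w \<le> x \<and> blinfun_apply (\<phi> i) (x - w) < e \<and> blinfun_apply (\<phi> j) w < e))"

lemma separated_pos: "separated_on_cone \<phi> \<Longrightarrow> positive_functional (\<phi> i)"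
  by (simp add: separated_on_cone_def)

lemma separated_from_finite:
  fixes \<phi> :: "'i \<Rightarrow> ('a::banach_lattice \<Rightarrow>\<^sub>L real)"
  assumes sep: "separated_on_cone \<phi>" and F: "finite F" "n \<notin> F" and x: "0 \<le> x" and e: "0 < e"
  shows "\<exists>w. 0 \<le> w \<and> w \<le> x \<and> blinfun_apply (\<phi> n) (x - w) < e \<and> (\<forall>m\<in>F. blinfun_apply (\<phi> m) w < e)"
  using F e
proof (induction F arbitrary: e)
  case empty
  then show ?case using x by (intro exI[of _ x]) simp
next
  case (insert m F)
  have "0 < e / 2" using insert.prems by simp
  with insert.IH insert.prems(1) obtain w where w: "0 \<le> w" "w \<le> x" "blinfun_apply (\<phi> n) (x - w) < e / 2"
    "\<forall>m\<in>F. blinfun_apply (\<phi> m) w < e / 2" by blast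
  have "n \<noteq> m" using insert.prems by blast
  with sep w(1) \<open>0 < e / 2\<close> obtain v where v: "0 \<le> v" "v \<le> w" "blinfun_apply (\<phi> n) (w - v) < e / 2"
    "blinfun_apply (\<phi> m) v < e / 2" unfolding separated_on_cone_def by blast
  show ?case
  proof (intro exI[of _ v] conjI ballI)
    show "v \<le> x" using v(2) w(2) by (rule order_trans)
    have "blinfun_apply (\<phi> n) (x - v) = blinfun_apply (\<phi> n) (x - w) + blinfun_apply (\<phi> n) (w - v)"
      by (simp flip: blinfun.add_right)
    then show "blinfun_apply (\<phi> n) (x - v) < e" using w(3) v(3) by simp
    fix k assume "k \<in> insert m F"
    then show "blinfun_apply (\<phi> k) v < e"
      using v(4) w(4) \<open>0 < e / 2\<close> positive_functional_mono[OF separated_pos[OF sep] v(2), of k] by force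
  qed (rule v)
qed

text \<open>The element \<open>w\<close> chosen for the new index \<open>n\<close> carries nearly all of \<open>\<phi> n\<close> and almost nothing of the other
  functionals, so these can be treated inside \<open>x - w\<close>.\<close>
lemma separated_finite_decomposition:
  fixes \<phi> :: "'i \<Rightarrow> ('a::banach_lattice \<Rightarrow>\<^sub>L real)"
  assumes sep: "separated_on_cone \<phi>" and F: "finite F" and x: "0 \<le> x" and e: "0 < e"
  shows "\<exists>v. (\<forall>i\<in>F. 0 \<le> v i \<and> blinfun_apply (\<phi> i) x - e < blinfun_apply (\<phi> i) (v i)) \<and> (\<Sum>i\<in>F. v i) \<le> x"
  using F x e
proof (induction F arbitrary: x e)
  case empty
  then show ?case by simp
next
  case (insert n F)
  have e2: "0 < e / 2" using insert.prems by simp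
  obtain w where w: "0 \<le> w" "w \<le> x" "blinfun_apply (\<phi> n) (x - w) < e / 2"
    "\<forall>m\<in>F. blinfun_apply (\<phi> m) w < e / 2"
    using separated_from_finite[OF sep insert.hyps insert.prems(1) e2] by blast
  have "0 \<le> x - w" using w(2) by simp
  from insert.IH[OF this e2] obtain v where
    v: "\<forall>i\<in>F. 0 \<le> v i \<and> blinfun_apply (\<phi> i) (x - w) - e / 2 < blinfun_apply (\<phi> i) (v i)"
    "(\<Sum>i\<in>F. v i) \<le> x - w" by blast
  show ?case
  proof (intro exI[of _ "v(n := w)"] conjI ballI)
    fix i assume i: "i \<in> insert n F"
    show "0 \<le> (v(n := w)) i" using i v(1) w(1) by auto
    show "blinfun_apply (\<phi> i) x - e < blinfun_apply (\<phi> i) ((v(n := w)) i)"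
    proof (cases "i = n")
      case True
      then show ?thesis using w(3) insert.prems(2) by (simp add: blinfun.diff_right)
    next
      case False
      then have "i \<in> F" using i by blast
      from v(1)[rule_format, OF this] w(4)[rule_format, OF this] False
      show ?thesis by (simp add: blinfun.diff_right)
    qed
  next
    have "(\<Sum>i\<in>F. (v(n := w)) i) = (\<Sum>i\<in>F. v i)" using insert.hyps(2) by (intro sum.cong) auto
    then have "(\<Sum>i\<in>insert n F. (v(n := w)) i) = w + (\<Sum>i\<in>F. v i)" using insert.hyps by simp
    also have "\<dots> \<le> w + (x - w)" using v(2) by (rule add_left_mono)
    finally show "(\<Sum>i\<in>insert n F. (v(n := w)) i) \<le> x" by simp
  qed
qed

text \<open>Distribute \<open>y\<close> among many indices of \<open>I\<close> by the previous lemma. Since the pieces sum to at most \<open>y\<close>, each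
  \<open>\<phi> m\<close> is small on one of them, so a single piece \<open>v n\<close> is small for infinitely many \<open>m\<close>. Positive
  and negative part of \<open>v n - \<eta> y\<close>, the latter rescaled, are then disjoint: the first retains almost all of
  \<open>\<phi> n\<close>, and the second almost all of those \<open>\<phi> m\<close>.\<close>
lemma separated_extraction_step:
  fixes \<phi> :: "nat \<Rightarrow> ('a::banach_lattice \<Rightarrow>\<^sub>L real)"
  assumes sep: "separated_on_cone \<phi>" and I: "infinite I" and y: "0 \<le> y" and e: "0 < e"
    and M: "\<And>n. blinfun_apply (\<phi> n) y \<le> M"
  shows "\<exists>n v y' I'. n \<in> I \<and> I' \<subseteq> I \<and> infinite I' \<and> 0 \<le> v \<and> v \<le> y \<and> 0 \<le> y' \<and> y' \<le> y \<and> inf v y' = 0 \<and>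
    blinfun_apply (\<phi> n) y - e \<le> blinfun_apply (\<phi> n) v \<and>
    (\<forall>m\<in>I'. blinfun_apply (\<phi> m) y - e \<le> blinfun_apply (\<phi> m) y')"
proof -
  have M0: "0 \<le> M" using M[of 0] positive_functional_nonneg[OF separated_pos[OF sep] y, of 0] by simp
  define \<eta> where "\<eta> = e / (2 * (M + 1))"
  have \<eta>: "0 < \<eta>" "\<eta> * M \<le> e / 2" using M0 e by (auto simp: \<eta>_def field_simps)
  \<comment> \<open>pieces on each of which \<open>\<phi> m\<close> is at least \<open>\<eta> e\<close> number fewer than \<open>N\<close>\<close>
  obtain N where N: "M < real N * (\<eta> * e)" using reals_Archimedean3[of "\<eta> * e"] \<eta> e by (metis mult_pos_pos)
  obtain F where F: "finite F" "card F = N" "F \<subseteq> I" using infinite_arbitrarily_large[OF I] by blast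
  have e2: "0 < e / 2" using e by simp
  from separated_finite_decomposition[OF sep F(1) y e2] obtain v where
    v: "\<forall>i\<in>F. 0 \<le> v i \<and> blinfun_apply (\<phi> i) y - e / 2 < blinfun_apply (\<phi> i) (v i)" "(\<Sum>i\<in>F. v i) \<le> y"
    by blast
  have "\<exists>i\<in>F. infinite {m\<in>I. blinfun_apply (\<phi> m) (v i) < \<eta> * e}"
  proof (rule ccontr)
    assume "\<not> ?thesis"
    then have "finite (\<Union>i\<in>F. {m\<in>I. blinfun_apply (\<phi> m) (v i) < \<eta> * e})" using F(1) by blast
    then obtain m where m: "m \<in> I" "m \<notin> (\<Union>i\<in>F. {m\<in>I. blinfun_apply (\<phi> m) (v i) < \<eta> * e})"
      using I by (meson finite_subset subsetI)
    have "real N * (\<eta> * e) = (\<Sum>i\<in>F. \<eta> * e)" using F(2) by simp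
    also have "\<dots> \<le> (\<Sum>i\<in>F. blinfun_apply (\<phi> m) (v i))"
      by (intro sum_mono) (use m in \<open>simp add: not_less\<close>)
    also have "\<dots> = blinfun_apply (\<phi> m) (\<Sum>i\<in>F. v i)" by (simp add: blinfun.sum_right)
    also have "\<dots> \<le> blinfun_apply (\<phi> m) y" using separated_pos[OF sep] v(2) by (rule positive_functional_mono)
    also have "\<dots> \<le> M" by (rule M)
    finally show False using N by simp
  qed
  then obtain n where n: "n \<in> F" "infinite {m\<in>I. blinfun_apply (\<phi> m) (v n) < \<eta> * e}" by blast
  define I' where "I' = {m\<in>I. blinfun_apply (\<phi> m) (v n) < \<eta> * e}"
  define d where "d = v n - \<eta> *\<^sub>R y"
  have vn: "0 \<le> v n" "v n \<le> y" using v(1) n(1) order_trans[OF le_sum_member[of F n v] v(2)] F(1)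
    by simp_all
  have ey: "0 \<le> \<eta> *\<^sub>R y" using \<eta>(1) y by (intro scaleR_nonneg_nonneg) auto
  have "pprt d \<le> v n" using vn(1) ey by (simp add: pprt_def d_def)
  define y' where "y' = inverse \<eta> *\<^sub>R pprt (- d)"
  have y'_ge: "y - inverse \<eta> *\<^sub>R v n \<le> y'"
  proof -
    have "inverse \<eta> *\<^sub>R (- d) \<le> y'" unfolding y'_def using \<eta>(1) by (intro scaleR_left_mono) (auto simp: pprt_def)
    moreover have "inverse \<eta> *\<^sub>R (- d) = y - inverse \<eta> *\<^sub>R v n"
      using \<eta>(1) by (simp add: d_def scaleR_diff_right)
    ultimately show ?thesis by simp
  qed
  show ?thesis
  proof (intro exI conjI ballI)
    show "n \<in> I" using n(1) F(3) by blast
    show "I' \<subseteq> I" "infinite I'" using n(2) by (auto simp: I'_def)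
    show "0 \<le> pprt d" by simp
    show "pprt d \<le> y" using \<open>pprt d \<le> v n\<close> vn(2) by (rule order_trans)
    show "0 \<le> y'" unfolding y'_def using \<eta>(1) by (intro scaleR_nonneg_nonneg) auto
    show "y' \<le> y"
    proof -
      have "pprt (- d) \<le> \<eta> *\<^sub>R y" using vn(1) ey by (simp add: pprt_def d_def)
      then have "y' \<le> inverse \<eta> *\<^sub>R \<eta> *\<^sub>R y" unfolding y'_def using \<eta>(1) by (intro scaleR_left_mono) auto
      then show ?thesis using \<eta>(1) by simp
    qed
    show "inf (pprt d) y' = 0"
      unfolding y'_def using disjoint_pprt by (rule disjoint_scaleR) (use \<eta>(1) in simp)
    have "blinfun_apply (\<phi> n) y - e / 2 - \<eta> * blinfun_apply (\<phi> n) y \<le> blinfun_apply (\<phi> n) d"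
      using v(1) n(1) by (simp add: d_def blinfun.diff_right blinfun.scaleR_right less_imp_le)
    also have "\<dots> \<le> blinfun_apply (\<phi> n) (pprt d)"
      using separated_pos[OF sep] by (rule positive_functional_mono) (simp add: pprt_def)
    finally show "blinfun_apply (\<phi> n) y - e \<le> blinfun_apply (\<phi> n) (pprt d)"
      using mult_left_mono[OF M[of n], of \<eta>] \<eta> by linarith
    fix m assume "m \<in> I'"
    then have "inverse \<eta> * blinfun_apply (\<phi> m) (v n) \<le> e"
      using \<eta>(1) by (simp add: I'_def field_simps)
    then show "blinfun_apply (\<phi> m) y - e \<le> blinfun_apply (\<phi> m) y'"
      using positive_functional_mono[OF separated_pos[OF sep] y'_ge, of m]
      by (simp add: blinfun.diff_right blinfun.scaleR_right)
  qed
qed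

text \<open>Iterates the extraction step inside the remainder \<open>y\<close>, with losses \<open>e / 4, e / 8, ...\<close> so that at least
  \<open>e / 2\<close> always remains.\<close>
lemma separated_disjoint_elements:
  fixes \<phi> :: "nat \<Rightarrow> ('a::banach_lattice \<Rightarrow>\<^sub>L real)"
  assumes sep: "separated_on_cone \<phi>" and x: "0 \<le> x" and e: "0 < e"
    and M: "\<And>n. blinfun_apply (\<phi> n) x \<le> M" and big: "\<And>n. e \<le> blinfun_apply (\<phi> n) x"
  shows "\<exists>(r :: nat \<Rightarrow> nat) v. strict_mono r \<and> (\<forall>k. 0 \<le> v k \<and> v k \<le> x) \<and> (\<forall>j k. j \<noteq> k \<longrightarrow> inf (v j) (v k) = 0) \<and>
    (\<forall>k. e / 2 \<le> blinfun_apply (\<phi> (r k)) (v k))"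
proof -
  \<comment> \<open>a state consists of the extracted index and vector, the remainder, and the indices still available\<close>
  define ok where "ok k = (\<lambda>(n, v, y, I). infinite I \<and> I \<subseteq> {n<..} \<and> 0 \<le> v \<and> v \<le> x \<and> 0 \<le> y \<and> y \<le> x \<and> inf v y = 0 \<and>
      e / 2 \<le> blinfun_apply (\<phi> n) v \<and> (\<forall>m\<in>I. e / 2 + e / 2 ^ (k + 2) \<le> blinfun_apply (\<phi> m) y))" for k :: nat
  define nxt where "nxt = (\<lambda>(n::nat, v::'a, y::'a, I::nat set) (n'::nat, v'::'a, y'::'a, I'::nat set). n' \<in> I \<and> v' \<le> y \<and> y' \<le> y)"
  have pick: "\<exists>n' v' y' I'. ok k (n', v', y', I') \<and> n' \<in> I \<and> v' \<le> y \<and> y' \<le> y"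
    if "infinite I" "0 \<le> y" "y \<le> x" "\<And>m. m \<in> I \<Longrightarrow> e / 2 + e / 2 ^ (k + 1) \<le> blinfun_apply (\<phi> m) y" for k I y
  proof -
    have d: "0 < e / 2 ^ (k + 2)" using e by simp
    have "blinfun_apply (\<phi> n) y \<le> M" for n
      using positive_functional_mono[OF separated_pos[OF sep] that(3), of n] M[of n] by simp
    from separated_extraction_step[OF sep that(1,2) d this] obtain n v y' I' where
      1: "n \<in> I" "I' \<subseteq> I" "infinite I'" "0 \<le> v" "v \<le> y" "0 \<le> y'" "y' \<le> y" "inf v y' = 0"
        "blinfun_apply (\<phi> n) y - e / 2 ^ (k + 2) \<le> blinfun_apply (\<phi> n) v"
      and 2: "\<And>m. m \<in> I' \<Longrightarrow> blinfun_apply (\<phi> m) y - e / 2 ^ (k + 2) \<le> blinfun_apply (\<phi> m) y'"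
      by blast
    have half: "e / 2 ^ (k + 1) = e / 2 ^ (k + 2) + e / 2 ^ (k + 2)" by (simp add: field_simps)
    have "infinite (I' \<inter> {n<..})"
    proof -
      have "I' \<inter> {n<..} = I' - {..n}" by auto
      then show ?thesis using 1(3) by (simp add: Diff_infinite_finite)
    qed
    moreover have "e / 2 + e / 2 ^ (k + 2) \<le> blinfun_apply (\<phi> m) y'" if "m \<in> I'" for m
      using 2[OF that] \<open>\<And>m. m \<in> I \<Longrightarrow> e / 2 + e / 2 ^ (k + 1) \<le> blinfun_apply (\<phi> m) y\<close>[of m] that 1(2) half
      by force
    moreover have "e / 2 \<le> blinfun_apply (\<phi> n) v"
      using 1(9) that(4)[OF 1(1)] half d by linarith
    moreover have "v \<le> x" "y' \<le> x" using 1(5,7) that(3) by (auto intro: order_trans)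
    ultimately have "ok k (n, v, y', I' \<inter> {n<..})" using 1 by (simp add: ok_def)
    with 1 show ?thesis by blast
  qed
  have "\<exists>z. \<forall>k. ok k (z k) \<and> nxt (z k) (z (Suc k))"
  proof (intro dependent_nat_choice)
    have "e / 2 + e / 2 ^ (0 + 1) \<le> blinfun_apply (\<phi> m) x" for m using big[of m] by simp
    with pick[of UNIV x 0] x show "\<exists>z. ok 0 z" by auto
  next
    fix z k assume z: "ok k z"
    obtain n v y I where [simp]: "z = (n, v, y, I)" by (metis prod.exhaust)
    have "\<exists>n' v' y' I'. ok (Suc k) (n', v', y', I') \<and> n' \<in> I \<and> v' \<le> y \<and> y' \<le> y"
      by (rule pick) (use z in \<open>simp_all add: ok_def\<close>)
    then show "\<exists>z'. ok (Suc k) z' \<and> nxt z z'" by (auto simp: nxt_def)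
  qed
  then obtain z where z: "\<And>k. ok k (z k)" "\<And>k. nxt (z k) (z (Suc k))" by blast
  define r where "r k = fst (z k)" for k
  define v where "v k = fst (snd (z k))" for k
  define y where "y k = fst (snd (snd (z k)))" for k
  define I where "I k = snd (snd (snd (z k)))" for k
  have zk: "z k = (r k, v k, y k, I k)" for k by (simp add: r_def v_def y_def I_def)
  have ok: "I k \<subseteq> {r k<..}" "0 \<le> v k" "v k \<le> x" "0 \<le> y k" "inf (v k) (y k) = 0"
    "e / 2 \<le> blinfun_apply (\<phi> (r k)) (v k)" for k
    using z(1)[of k] by (simp_all add: zk ok_def)
  have succ: "r (Suc k) \<in> I k" "v (Suc k) \<le> y k" "y (Suc k) \<le> y k" for k
    using z(2)[of k] by (simp_all add: zk nxt_def)
  have r: "strict_mono r" using succ(1) ok(1) unfolding strict_mono_Suc_iff by blast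
  have dis: "inf (v j) (v k) = 0" if "j < k" for j k
  proof -
    have "v k \<le> y (k - 1)" using succ(2)[of "k - 1"] that by simp
    also have "\<dots> \<le> y j" by (rule lift_Suc_antimono_le[of y, OF succ(3)]) (use that in simp)
    finally show ?thesis by (rule disjoint_antimono[OF ok(5) ok(2) order_refl ok(2)])
  qed
  have dis': "inf (v j) (v k) = 0" if "j \<noteq> k" for j k
    using dis[of j k] dis[of k j] that by (cases "j < k") (auto simp: inf_commute)
  show ?thesis
    by (intro exI[of _ r] exI[of _ v] conjI allI impI r ok(2,3,6) dis')
qed

text \<open>Otherwise \<open>\<phi> n x \<ge> e\<close> along a subsequence, and there are disjoint \<open>v k\<close> in \<open>[0, x]\<close> on which the moduli
  are at least \<open>e / 2\<close>. By the supremum formula \<open>f\<close> itself exceeds \<open>e / 4\<close> at some \<open>y k\<close> with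
  \<open>\<bar>y k\<bar> \<le> v k\<close>, but the positive and negative parts of \<open>y k\<close> form disjoint order bounded sequences.\<close>
lemma weak_star_null_modulus:
  fixes f \<phi> :: "nat \<Rightarrow> ('a::banach_lattice \<Rightarrow>\<^sub>L real)"
  assumes sdc: "sigma_dedekind_complete TYPE('a)" and dis: "dual_disjoint_seq f" and f: "weak_star_null f"
    and \<phi>: "\<And>n. is_dual_abs (f n) (\<phi> n)"
  shows "weak_star_null \<phi>"
proof -
  have pos: "positive_functional (\<phi> n)" for n using \<phi> by (rule dual_modulus_pos)
  have "is_dual_inf (\<phi> i) (\<phi> j) 0" if "i \<noteq> j" for i j
  proof -
    obtain u v where "is_dual_abs (f i) u" "is_dual_abs (f j) v" "is_dual_inf u v 0"
      using dis \<open>i \<noteq> j\<close> unfolding dual_disjoint_seq_def by blast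
    moreover from this have "u = \<phi> i" "v = \<phi> j" using \<phi> is_dual_abs_unique by blast+
    ultimately show ?thesis by simp
  qed
  then have sep: "separated_on_cone \<phi>"
    unfolding separated_on_cone_def using pos disjoint_functionals_split[OF pos pos] by blast
  obtain B where B: "\<And>n. norm (f n) \<le> B" using weak_star_null_bounded[OF f] by blast
  have null: "(\<lambda>n. blinfun_apply (\<phi> n) x) \<longlonglongrightarrow> 0" if x: "0 \<le> x" for x
  proof (rule ccontr)
    assume "\<not> ?thesis"
    then obtain e and s :: "nat \<Rightarrow> nat"
      where e: "0 < e" and s: "strict_mono s" "\<And>n. e \<le> \<bar>blinfun_apply (\<phi> (s n)) x\<bar>"
      using not_tendsto_0_subseq by blast
    have seps: "separated_on_cone (\<lambda>n. \<phi> (s n))"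
      using sep s(1) unfolding separated_on_cone_def by (simp add: strict_mono_eq)
    have bound: "blinfun_apply (\<phi> (s n)) x \<le> B * norm x" for n
      using dual_modulus_le_norm[OF \<phi> x, of "s n"] mult_right_mono[OF B, of "norm x" "s n"] by simp
    have big: "e \<le> blinfun_apply (\<phi> (s n)) x" for n
      using s(2)[of n] positive_functional_nonneg[OF pos x, of "s n"] by simp
    from separated_disjoint_elements[OF seps x e bound big]
    obtain r :: "nat \<Rightarrow> nat" and v where r: "strict_mono r" and v: "\<And>k. 0 \<le> v k" "\<And>k. v k \<le> x"
      "\<And>j k. j \<noteq> k \<Longrightarrow> inf (v j) (v k) = 0" "\<And>k. e / 2 \<le> blinfun_apply (\<phi> (s (r k))) (v k)"
      by blast
    define g where "g k = f (s (r k))" for k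
    have g: "weak_star_null g"
      unfolding g_def using f s(1) r by (intro weak_star_null_subseq[of f "\<lambda>k. s (r k)"]) (simp_all add: strict_mono_def)
    have "\<exists>y. \<bar>y\<bar> \<le> v k \<and> e / 4 < blinfun_apply (g k) y" for k
    proof -
      have "0 < e / 4" using e by simp
      from dual_modulus_formula(1)[OF \<phi>[of "s (r k)"] v(1)[of k] this] obtain y
        where y: "\<bar>y\<bar> \<le> v k" "blinfun_apply (\<phi> (s (r k))) (v k) - e / 4 < blinfun_apply (g k) y"
        unfolding g_def by blast
      have "e / 4 < blinfun_apply (g k) y" using y(2) v(4)[of k] by linarith
      with y(1) show ?thesis by blast
    qed
    then obtain y where y: "\<And>k. \<bar>y k\<bar> \<le> v k" "\<And>k. e / 4 < blinfun_apply (g k) (y k)" by metis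
    have to0: "(\<lambda>k. blinfun_apply (g k) (w k)) \<longlonglongrightarrow> 0" if w: "\<And>k. 0 \<le> w k" "\<And>k. w k \<le> v k" for w
    proof (rule weak_star_null_disjoint_order_bounded[OF sdc g w(1)])
      show "w k \<le> x" for k using w(2) v(2) by (rule order_trans)
      show "inf (w j) (w k) = 0" if "j \<noteq> k" for j k
        by (rule disjoint_antimono[OF v(3)[OF that] w(1) w(2) w(1) w(2)])
    qed
    have "(\<lambda>k. blinfun_apply (g k) (pprt (y k)) - blinfun_apply (g k) (pprt (- y k))) \<longlonglongrightarrow> 0 - 0"
    proof (intro tendsto_diff to0)
      show "pprt (y k) \<le> v k" "pprt (- y k) \<le> v k" for k
        using pprt_le_abs[of "y k"] y(1)[of k] by (auto intro: order_trans)
    qed simp_all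
    then have "(\<lambda>k. blinfun_apply (g k) (y k)) \<longlonglongrightarrow> 0" by (simp add: diff_pprt flip: blinfun.diff_right)
    then have "e / 4 \<le> 0" by (rule LIMSEQ_le_const) (use y(2) less_imp_le in blast)
    with e show False by simp
  qed
  show ?thesis
    unfolding weak_star_null_def
  proof
    fix x
    have "(\<lambda>n. blinfun_apply (\<phi> n) (pprt x) - blinfun_apply (\<phi> n) (pprt (- x))) \<longlonglongrightarrow> 0 - 0"
      by (intro tendsto_diff null zero_le_pprt)
    then show "(\<lambda>n. blinfun_apply (\<phi> n) x) \<longlonglongrightarrow> 0" by (simp add: diff_pprt flip: blinfun.diff_right)
  qed
qed

section \<open>From limited disjoint sequences to almost limited sets\<close>

text \<open>The classical formula, for a sparse subsequence \<open>w n\<close> of \<open>u\<close>, is \<open>z n = pprt (w n - S n - 2^-n x)\<close>. Here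
  \<open>x = \<Sum> 2^-n w n\<close>, and \<open>S n\<close> is \<open>4^n\<close> or more times the sum of all earlier terms. For \<open>m < n\<close> the vector \<open>z m\<close>
  lies below the positive part of \<open>w m - 4^-n w n\<close> because \<open>x\<close> contains \<open>w n\<close>, and \<open>z n\<close> below \<open>4^n\<close> times
  its negative part because \<open>S n\<close> contains \<open>4^n w m\<close>. Both subtracted terms are small for \<open>\<phi>\<close>: the first by
  the choice of the subsequence, the second eventually.\<close>
lemma disjoint_minorants_of_bounded_seq:
  fixes u :: "nat \<Rightarrow> 'a::banach_lattice"
  assumes u: "\<And>n. 0 \<le> u n" "\<And>n. norm (u n) \<le> B"
    and pos: "\<And>n. positive_functional (\<phi> n)" and null: "weak_star_null \<phi>" and e: "0 < e"
    and big: "\<And>n. e \<le> blinfun_apply (\<phi> n) (u n)"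
  shows "\<exists>r z. strict_mono r \<and> (\<forall>n. 0 \<le> z n \<and> z n \<le> u (r n)) \<and> (\<forall>m n. m \<noteq> n \<longrightarrow> inf (z m) (z n) = 0) \<and>
    eventually (\<lambda>n. e / 2 \<le> blinfun_apply (\<phi> (r n)) (z n)) sequentially"
proof -
  define S where "S m = (4 ^ m) *\<^sub>R (\<Sum>i\<le>m. u i)" for m
  have S: "0 \<le> S m" for m unfolding S_def using u(1) by (intro scaleR_nonneg_nonneg sum_nonneg) auto
  have "eventually (\<lambda>n. blinfun_apply (\<phi> n) (S m) < e / 4) sequentially" for m
    using order_tendstoD(2)[of "\<lambda>n. blinfun_apply (\<phi> n) (S m)" 0 sequentially "e / 4"] null e
    by (simp add: weak_star_null_def)
  then obtain r :: "nat \<Rightarrow> nat" where r: "strict_mono r" "\<And>j. blinfun_apply (\<phi> (r (Suc j))) (S (r j)) < e / 4"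
    using strict_mono_dependent_selection[of "\<lambda>m n. blinfun_apply (\<phi> n) (S m) < e / 4"] by blast
  define w where "w n = u (r (Suc n))" for n
  define x where "x = (\<Sum>n. (1 / 2 ^ n) *\<^sub>R w n)"
  have summ: "summable (\<lambda>n. (1 / 2 ^ n) *\<^sub>R w n)"
  proof (rule summable_comparison_test')
    show "summable (\<lambda>n. B * (1 / 2) ^ n)" by (intro summable_mult summable_geometric) simp
    show "norm ((1 / 2 ^ n) *\<^sub>R w n) \<le> B * (1 / 2) ^ n" for n
      using u(2)[of "r (Suc n)"] by (simp add: w_def field_simps power_divide)
  qed
  have wx: "(1 / 2 ^ n) *\<^sub>R w n \<le> x" for n
  proof (rule lattice_le_limit[OF summable_LIMSEQ[OF summ, folded x_def]])
    show "eventually (\<lambda>N. (1 / 2 ^ n) *\<^sub>R w n \<le> (\<Sum>k<N. (1 / 2 ^ k) *\<^sub>R w k)) sequentially"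
      using eventually_gt_at_top[of n]
    proof eventually_elim
      case (elim N)
      then show ?case
        using u(1) by (intro le_sum_member) (auto simp: w_def intro!: scaleR_nonneg_nonneg)
    qed
  qed
  have x: "0 \<le> x" using wx[of 0] u(1)[of "r (Suc 0)"] by (simp add: w_def)
  define z where "z n = pprt (w n - S (r n) - (1 / 2 ^ n) *\<^sub>R x)" for n
  have sx: "0 \<le> (1 / 2 ^ n) *\<^sub>R x" for n using x by (intro scaleR_nonneg_nonneg) auto
  have z: "0 \<le> z n" "z n \<le> w n" for n
  proof -
    have "w n - S (r n) - (1 / 2 ^ n) *\<^sub>R x \<le> w n"
      using add_nonneg_nonneg[OF S[of "r n"] sx[of n]] by (simp add: algebra_simps)
    then show "0 \<le> z n" "z n \<le> w n" using u(1) by (simp_all add: z_def pprt_def w_def)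
  qed
  have dis: "inf (z m) (z n) = 0" if mn: "m < n" for m n
  proof -
    define d where "d = w m - (1 / 4 ^ n) *\<^sub>R w n"
    have "z m \<le> pprt d"
      unfolding z_def
    proof (rule pprt_mono)
      have "(1 / 4 ^ n) *\<^sub>R w n \<le> (1 / 2 ^ m) *\<^sub>R (1 / 2 ^ n) *\<^sub>R w n"
      proof -
        have "(2::real) ^ m * 2 ^ n \<le> 2 ^ n * 2 ^ n" using mn by (intro mult_right_mono power_increasing) auto
        then have "(2::real) ^ m * 2 ^ n \<le> 4 ^ n" by (simp flip: power_mult_distrib)
        then have "1 / 4 ^ n \<le> 1 / (2 ^ m * (2::real) ^ n)" by (intro divide_left_mono) auto
        then show ?thesis using u(1)[of "r (Suc n)"] by (simp add: w_def scaleR_right_mono)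
      qed
      also have "\<dots> \<le> (1 / 2 ^ m) *\<^sub>R x" using wx by (intro scaleR_left_mono) auto
      finally have "(1 / 4 ^ n) *\<^sub>R w n \<le> (1 / 2 ^ m) *\<^sub>R x" .
      from add_mono[OF S[of "r m"] this]
      show "w m - S (r m) - (1 / 2 ^ m) *\<^sub>R x \<le> d" by (simp add: d_def algebra_simps)
    qed
    moreover have "z n \<le> (4 ^ n) *\<^sub>R pprt (- d)"
    proof -
      have "(4 ^ n) *\<^sub>R w m \<le> S (r n)"
      proof -
        have "w m \<le> (\<Sum>i\<le>r n. u i)"
          unfolding w_def using mn r(1) u(1)
          by (intro le_sum_member) (auto simp: strict_mono_less_eq)
        then have "(4 ^ n) *\<^sub>R w m \<le> (4 ^ n) *\<^sub>R (\<Sum>i\<le>r n. u i)" by (intro scaleR_left_mono) auto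
        also have "\<dots> \<le> (4 ^ r n) *\<^sub>R (\<Sum>i\<le>r n. u i)"
          using seq_suble[OF r(1), of n] u(1) by (intro scaleR_right_mono power_increasing sum_nonneg) auto
        finally show ?thesis by (simp add: S_def)
      qed
      from add_mono[OF this sx[of n]]
      have "w n - S (r n) - (1 / 2 ^ n) *\<^sub>R x \<le> w n - (4 ^ n) *\<^sub>R w m" by (simp add: algebra_simps)
      also have "\<dots> = (4 ^ n) *\<^sub>R (- d)" by (simp add: d_def scaleR_diff_right)
      also have "\<dots> \<le> (4 ^ n) *\<^sub>R pprt (- d)" by (intro scaleR_left_mono) (auto simp: pprt_def)
      finally show ?thesis unfolding z_def pprt_def[of "w n - _ - _"]
        by (rule le_supI) (intro scaleR_nonneg_nonneg, auto)
    qed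
    moreover have "inf (pprt d) ((4 ^ n) *\<^sub>R pprt (- d)) = 0"
      using disjoint_pprt by (rule disjoint_scaleR) simp
    ultimately show ?thesis using z(1) by (meson disjoint_antimono)
  qed
  have "inf (z m) (z n) = 0" if "m \<noteq> n" for m n
    using dis[of m n] dis[of n m] that by (cases "m < n") (auto simp: inf_commute)
  moreover have "eventually (\<lambda>n. e / 2 \<le> blinfun_apply (\<phi> (r (Suc n))) (z n)) sequentially"
  proof -
    have "(\<lambda>n. blinfun_apply (\<phi> (r (Suc n))) x) \<longlonglongrightarrow> 0"
      using weak_star_null_subseq[OF null, of "\<lambda>n. r (Suc n)"] r(1)
      by (simp add: weak_star_null_def strict_mono_def)
    from order_tendstoD(2)[OF this, of "e / 4"] e
    have "eventually (\<lambda>n. blinfun_apply (\<phi> (r (Suc n))) x < e / 4) sequentially" by simp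
    then show ?thesis
    proof eventually_elim
      case (elim n)
      let ?\<phi> = "\<phi> (r (Suc n))"
      have "(1 / 2 ^ n) * blinfun_apply ?\<phi> x \<le> 1 * blinfun_apply ?\<phi> x"
        using positive_functional_nonneg[OF pos x] by (intro mult_right_mono) auto
      moreover have "e \<le> blinfun_apply ?\<phi> (w n)" unfolding w_def by (rule big)
      ultimately have "e / 2 \<le> blinfun_apply ?\<phi> (w n - S (r n) - (1 / 2 ^ n) *\<^sub>R x)"
        using r(2)[of n] elim by (simp add: blinfun.diff_right blinfun.scaleR_right)
      also have "\<dots> \<le> blinfun_apply ?\<phi> (z n)"
        using pos by (rule positive_functional_mono) (simp add: z_def pprt_def)
      finally show ?case .
    qed
  qed
  moreover have "strict_mono (\<lambda>n. r (Suc n))" using r(1) by (simp add: strict_mono_def)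
  moreover have "0 \<le> z n \<and> z n \<le> u (r (Suc n))" for n using z[of n] by (simp add: w_def)
  ultimately show ?thesis
    by (intro exI[of _ "\<lambda>n. r (Suc n)"] exI[of _ z] conjI allI impI) simp_all
qed

text \<open>If \<open>\<bar>f n (x n)\<bar> \<ge> e\<close> infinitely often, the moduli of the \<open>f n\<close> are a weak* null sequence that does not
  tend to 0 uniformly on suitable disjoint minorants of the \<open>\<bar>x n\<bar>\<close>, and these are weakly
  \<open>p\<close>-summable.\<close>
lemma sequential_if_disjoint_DP_star:
  fixes x :: "nat \<Rightarrow> 'a::banach_lattice"
  assumes p: "1 \<le> p" and sdc: "sigma_dedekind_complete TYPE('a)" and dp: "disjoint_DP_star p TYPE('a)"
    and x: "weakly_p_summable p x" and f: "dual_disjoint_seq f" "weak_star_null f"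
  shows "(\<lambda>n. blinfun_apply (f n) (x n)) \<longlonglongrightarrow> 0"
proof (rule ccontr)
  assume "\<not> ?thesis"
  then obtain e and s :: "nat \<Rightarrow> nat"
    where e: "0 < e" and s: "strict_mono s" "\<And>n. e \<le> \<bar>blinfun_apply (f (s n)) (x (s n))\<bar>"
    using not_tendsto_0_subseq by blast
  have "\<exists>u. is_dual_abs (f n) u" for n using dual_modulus_exists by metis
  then obtain \<phi> where \<phi>: "\<And>n. is_dual_abs (f n) (\<phi> n)" by metis
  have null: "weak_star_null \<phi>" using sdc f \<phi> by (rule weak_star_null_modulus)
  obtain B where B: "\<And>n. norm (x n) \<le> B" using weakly_p_summable_bounded[OF p x] by blast
  have "\<exists>r z. strict_mono r \<and> (\<forall>n. 0 \<le> z n \<and> z n \<le> \<bar>x (s (r n))\<bar>) \<and> (\<forall>m n. m \<noteq> n \<longrightarrow> inf (z m) (z n) = 0) \<and>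
    eventually (\<lambda>n. e / 2 \<le> blinfun_apply (\<phi> (s (r n))) (z n)) sequentially"
  proof (rule disjoint_minorants_of_bounded_seq)
    show "norm \<bar>x (s n)\<bar> \<le> B" for n using B by simp
    show "positive_functional (\<phi> (s n))" for n using \<phi> by (rule dual_modulus_pos)
    show "weak_star_null (\<lambda>n. \<phi> (s n))" using null s(1) by (rule weak_star_null_subseq)
    show "e \<le> blinfun_apply (\<phi> (s n)) \<bar>x (s n)\<bar>" for n
      using s(2)[of n] dual_modulus_ge[OF \<phi> order_refl, of "s n" "x (s n)"] by simp
  qed (use e in auto)
  then obtain r z where r: "strict_mono r" and z: "\<And>n. 0 \<le> z n" "\<And>n. z n \<le> \<bar>x (s (r n))\<bar>"
    "\<And>m n. m \<noteq> n \<Longrightarrow> inf (z m) (z n) = 0"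
    and big: "eventually (\<lambda>n. e / 2 \<le> blinfun_apply (\<phi> (s (r n))) (z n)) sequentially" by blast
  have sr: "strict_mono (\<lambda>n. s (r n))" using s(1) r by (simp add: strict_mono_def)
  have "weakly_p_summable p (\<lambda>n. x (s (r n)))"
    by (rule weakly_p_summable_subseq[OF x strict_mono_imp_inj_on[OF sr]])
  then have "weakly_p_summable p z" using z by (rule weakly_p_summable_disjoint_minorant[OF p])
  moreover have "disjoint_seq z" using z(1,3) by (simp add: disjoint_seq_def)
  ultimately have "limited (range z)" using dp by (simp add: disjoint_DP_star_def)
  then have "uniform_limit (range z) (\<lambda>n. blinfun_apply (\<phi> (s (r n)))) (\<lambda>_. 0) sequentially"
    using weak_star_null_subseq[OF null sr] by (simp add: limited_def)
  from uniform_limitD[OF this, of "e / 2"] e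
  have "eventually (\<lambda>n. \<forall>y\<in>range z. dist (blinfun_apply (\<phi> (s (r n))) y) 0 < e / 2) sequentially" by simp
  from this big have "eventually (\<lambda>_. False) sequentially"
  proof eventually_elim
    case (elim n)
    show ?case using bspec[OF elim(1) rangeI[of z n]] elim(2) by (simp add: dist_real_def)
  qed
  then show False by simp
qed

theorem theorem3p7:
  fixes p :: real
  assumes "p \<ge> 1"
    and "sigma_dedekind_complete TYPE('a::banach_lattice)"
  shows "(p_weak_DP_star p TYPE('a) \<longrightarrow> disjoint_DP_star p TYPE('a)) \<and>
         (p \<ge> 2 \<longrightarrow> (p_weak_DP_star p TYPE('a) \<longleftrightarrow> disjoint_DP_star p TYPE('a)))"
proof -
  have "p_weak_DP_star p TYPE('a) \<longleftrightarrow> disjoint_DP_star p TYPE('a)"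
  proof
    assume "p_weak_DP_star p TYPE('a)"
    then show "disjoint_DP_star p TYPE('a)"
      unfolding p_weak_DP_star_iff_sequential[OF assms(1)]
      by (intro disjoint_DP_star_if_sequential[OF assms(2)]) blast
  next
    assume "disjoint_DP_star p TYPE('a)"
    then show "p_weak_DP_star p TYPE('a)"
      unfolding p_weak_DP_star_iff_sequential[OF assms(1)]
      using sequential_if_disjoint_DP_star[OF assms] by blast
  qed
  then show ?thesis by blast
qed

end
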